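(* For all integers $k\ge 3$ and $n\ge 0$, \begin{align*} c\phi_{3}\Big(3^{2k}n+\tfrac{7\cdot 3^{2k}+1}{8} \Big) &\equiv 0 \pmod{3^{4k+5}},\\ c\phi_{3}\Big(3^{2k+1}n+\tfrac{5\cdot 3^{2k+1}+1}{8} \Big) &\equiv 0 \pmod{3^{4k+6}},\\ c\phi_{3}\Big(3^{2k+1}n+\tfrac{23\cdot 3^{2k}+1}{8}\Big) &\equiv 0 \pmod{3^{4k+7}},\\ c\phi_{3}\Big(3^{2k+2}n+\tfrac{13\cdot 3^{2k+1}+1}{8}\Big) &\equiv 0 \pmod{3^{4k+8}}. \end{align*}
   Context: For a positive integer $k$, color each nonnegative integer with each of $k$ colors $1,\dots,k$, writing $a_c$ for $a$ with color $c$, and order colored integers by $0_1\prec 0_2\prec\cdots\prec 0_k\prec 1_1\prec\cdots\prec 1_k\prec 2_1\prec\cdots$. A $k$-colored generalized Frobenius partition of $n$ is a two-row array $\begin{pmatrix} a_1,\dots,a_r\\ b_1,\dots,b_r\end{pmatrix}$ of colored integers with $a_r\prec a_{r-1}\prec\cdots\prec a_1$ and $b_r\prec\cdots\prec b_1$ and $n=r+\sum_{i=1}^r(a_i+b_i)$ (the sum using the underlying integers). $c\phi_k(n)$ denotes the number of $k$-colored generalized Frobenius partitions of $n$. Equivalently, $\sum_{n\ge0}c\phi_k(n)q^n=\frac{1}{(q;q)_\infty^k}\sum_{m_1,\dots,m_{k-1}\in\mathbb{Z}}q^{\sum_i m_i^2+\sum_{i<j}m_im_j}$, where $(q;q)_\infty=\prod_{n\ge1}(1-q^n)$.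 *)

theory Defs
  imports "HOL-Number_Theory.Cong"
begin

text \<open>
  A colored integer \<open>a\<^sub>c\<close> is the pair \<open>(a, c)\<close>, with colors \<open>c \<in> {1..k}\<close>.
  The order compares the underlying integers first and then the colors.
\<close>

definition colored_ints :: "nat \<Rightarrow> (nat \<times> nat) set" where
  "colored_ints k = UNIV \<times> {1..k}"

definition colored_less :: "nat \<times> nat \<Rightarrow> nat \<times> nat \<Rightarrow> bool" where
  "colored_less x y \<longleftrightarrow> (x, y) \<in> less_than <*lex*> less_than"

text \<open>
  An array is the pair of its rows, listed from left to right. The empty array (\<open>r = 0\<close>) is
  allowed; it is the only array for \<open>n = 0\<close>.
\<close>

definition gen_frob_partitions :: "nat \<Rightarrow> nat \<Rightarrow> ((nat \<times> nat) list \<times> (nat \<times> nat) list) set" where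
  "gen_frob_partitions k n =
     {(as, bs). length as = length bs \<and>
        set as \<subseteq> colored_ints k \<and> set bs \<subseteq> colored_ints k \<and>
        sorted_wrt (\<lambda>x y. colored_less y x) as \<and> sorted_wrt (\<lambda>x y. colored_less y x) bs \<and>
        n = length as + (\<Sum>i<length as. fst (as ! i) + fst (bs ! i))}"

definition cphi :: "nat \<Rightarrow> nat \<Rightarrow> nat" where
  "cphi k n = card (gen_frob_partitions k n)"

lemma colored_less_iff: "colored_less (a, c) (b, d) \<longleftrightarrow> a < b \<or> a = b \<and> c < d"
  by (simp add: colored_less_def)

lemma finite_gen_frob_partitions: "finite (gen_frob_partitions k n)"
proof (rule finite_subset)
  let ?L = "{xs. set xs \<subseteq> {..n} \<times> {1..k} \<and> length xs \<le> n}"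
  show "finite (?L \<times> ?L)"
    by (intro finite_cartesian_product finite_lists_length_le) auto
  show "gen_frob_partitions k n \<subseteq> ?L \<times> ?L"
  proof
    fix p assume "p \<in> gen_frob_partitions k n"
    then obtain as bs where p: "p = (as, bs)" and len: "length as = length bs"
      and sub: "set as \<subseteq> UNIV \<times> {1..k}" "set bs \<subseteq> UNIV \<times> {1..k}"
      and n: "n = length as + (\<Sum>i<length as. fst (as ! i) + fst (bs ! i))"
      by (auto simp: gen_frob_partitions_def colored_ints_def)
    have le: "fst (as ! i) + fst (bs ! i) \<le> n" if "i < length as" for i
      using member_le_sum[of i "{..<length as}" "\<lambda>i. fst (as ! i) + fst (bs ! i)"] that n
      by simp
    have "fst x \<le> n" if "x \<in> set as \<union> set bs" for x
      using that le len by (force simp: in_set_conv_nth)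
    with sub len n show "p \<in> ?L \<times> ?L"
      unfolding p by fastforce
  qed
qed

text \<open>The congruences for \<open>cphi 3\<close> have arguments with quotients by 8; these are all exact.\<close>

lemma eight_dvd:
  "(8::nat) dvd 7 * 3 ^ (2 * k) + 1"  "(8::nat) dvd 5 * 3 ^ (2 * k + 1) + 1"
  "(8::nat) dvd 23 * 3 ^ (2 * k) + 1" "(8::nat) dvd 13 * 3 ^ (2 * k + 1) + 1"
proof -
  have "(9::nat) ^ k mod 8 = (9 mod 8) ^ k mod 8"
    by (rule power_mod[symmetric])
  then have "(3::nat) ^ (2 * k) mod 8 = 1"
    by (simp add: power_mult)
  then obtain q where "(3::nat) ^ (2 * k) = 8 * q + 1"
    by (metis mult_div_mod_eq)
  then show "(8::nat) dvd 7 * 3 ^ (2 * k) + 1" "(8::nat) dvd 5 * 3 ^ (2 * k + 1) + 1"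
    "(8::nat) dvd 23 * 3 ^ (2 * k) + 1" "(8::nat) dvd 13 * 3 ^ (2 * k + 1) + 1"
    by (simp, presburger?)+
qed

end

theory Submission
  imports Defs Complex_Main "HOL-Computational_Algebra.Formal_Power_Series"
    "HOL-Library.Product_Lexorder" "HOL-Library.Product_Plus"
begin

text \<open>
  A 3-colored Frobenius partition is a triple of fermionic states (finite sets of integers) of total
  charge zero. Translation of states shows that the generating function of \<open>cphi 3\<close> is \<open>a Q\<^sup>3\<close>, where
  \<open>Q\<close>, the reciprocal of \<open>\<Prod>(1 - q\<^sup>n)\<close>, counts neutral states and \<open>a\<close> is the theta series of \<open>x\<^sup>2 + x y + y\<^sup>2\<close>. Interleaving three
  states, and weighting three states by cube roots of unity, gives Borwein's cubic theta functions
  \<open>b = Q(q\<^sup>3) / Q\<^sup>3\<close> and \<open>c = Q / Q(q\<^sup>3)\<^sup>3\<close>, with \<open>a = A + 2 L\<close> and \<open>b = A - L\<close>, where \<open>A = a(q\<^sup>3)\<close> and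
  \<open>L = 3 q c(q\<^sup>3)\<close>, and \<open>a\<^sup>3 = b\<^sup>3 + 27 q c\<^sup>3\<close>.

  Put \<open>h = 27 q c\<^sup>3 / b\<^sup>3\<close>. Then \<open>h = 9 L (A\<^sup>2 + A L + L\<^sup>2)\<^sup>4 / b(q\<^sup>3)\<^sup>9\<close>, so each factor \<open>h\<close> contributes a
  factor 9 and a form in \<open>A\<close>, \<open>L\<close>. Extracting a residue class modulo 3 selects the
  monomials of these forms by their degree in \<open>L\<close>. This makes \<open>a Q\<^sup>1\<^sup>2 / Q(q\<^sup>3)\<^sup>9 \<int>[h]\<close> and
  \<open>a Q\<^sup>1\<^sup>5 / Q(q\<^sup>3)\<^sup>1\<^sup>2 \<int>[h]\<close> alternate, with a gain of \<open>81\<close> and of \<open>3\<close>. Along the main progressions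
  the exponent of 3 is thus \<open>5 k + 2\<close> and \<open>5 k + 3\<close>, which suffices for \<open>k \<ge> 3\<close>; choosing the other
  residue class in the last step gains another factor 9.
\<close>

unbundle fps_syntax

section \<open>Generating functions of weighted sets\<close>

text \<open>Coefficients are complex so that states can later be weighted by cube roots of unity. A
  sum over an infinite fibre would take the default value 0, hence \<open>finite_fibres\<close> in
  the rules for unions and products.\<close>

definition gf :: "'s set \<Rightarrow> ('s \<Rightarrow> nat) \<Rightarrow> ('s \<Rightarrow> complex) \<Rightarrow> complex fps" where
  "gf X w c = Abs_fps (\<lambda>n. \<Sum>x\<in>{x\<in>X. w x = n}. c x)"

definition finite_fibres :: "'s set \<Rightarrow> ('s \<Rightarrow> nat) \<Rightarrow> bool" where
  "finite_fibres X w \<longleftrightarrow> (\<forall>n. finite {x\<in>X. w x = n})"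

lemma gf_nth: "gf X w c $ n = (\<Sum>x\<in>{x\<in>X. w x = n}. c x)"
  by (simp add: gf_def)

lemma gf_reindex:
  assumes "bij_betw h X Y" "\<And>x. x \<in> X \<Longrightarrow> w' (h x) = w x" "\<And>x. x \<in> X \<Longrightarrow> c' (h x) = c x"
  shows "gf Y w' c' = gf X w c"
proof (rule fps_ext)
  fix n
  have "{y\<in>Y. w' y = n} = h ` {x\<in>X. w x = n}"
    using assms(1,2) by (auto simp: bij_betw_def)
  moreover have "inj_on h {x\<in>X. w x = n}"
    using assms(1) by (auto simp: bij_betw_def intro: inj_on_subset)
  ultimately show "gf Y w' c' $ n = gf X w c $ n"
    using assms(3) by (simp add: gf_nth sum.reindex)
qed

lemma gf_cong:
  assumes "\<And>x. x \<in> X \<Longrightarrow> w x = w' x" "\<And>x. x \<in> X \<Longrightarrow> c x = c' x"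
  shows "gf X w c = gf X w' c'"
  by (rule gf_reindex[where h = id]) (use assms in auto)

lemma gf_Un:
  assumes "finite_fibres X w" "finite_fibres Y w" "X \<inter> Y = {}"
  shows "gf (X \<union> Y) w c = gf X w c + gf Y w c"
proof (rule fps_ext)
  fix n
  have "{x\<in>X \<union> Y. w x = n} = {x\<in>X. w x = n} \<union> {x\<in>Y. w x = n}" by auto
  then show "gf (X \<union> Y) w c $ n = (gf X w c + gf Y w c) $ n"
    using assms unfolding gf_nth finite_fibres_def fps_add_nth
    by (simp only:) (rule sum.union_disjoint, auto)
qed

lemma gf_cmult: "gf X w (\<lambda>x. k * c x) = fps_const k * gf X w c"
  by (rule fps_ext) (simp add: gf_nth sum_distrib_left)

text \<open>The fibre over \<open>n\<close> splits by the weight of the first component, which gives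
  the Cauchy product.\<close>

lemma gf_Times:
  assumes "finite_fibres X w" "finite_fibres Y v"
  shows "gf (X \<times> Y) (\<lambda>(x, y). w x + v y) (\<lambda>(x, y). c x * d y) = gf X w c * gf Y v d"
proof (rule fps_ext)
  fix n
  let ?F = "\<lambda>i. {x\<in>X. w x = i} \<times> {y\<in>Y. v y = n - i}"
  have eq: "{p\<in>X \<times> Y. (case p of (x, y) \<Rightarrow> w x + v y) = n} = (\<Union>i\<in>{0..n}. ?F i)"
    by auto
  have "gf (X \<times> Y) (\<lambda>(x, y). w x + v y) (\<lambda>(x, y). c x * d y) $ n
      = (\<Sum>i=0..n. \<Sum>p\<in>?F i. case p of (x, y) \<Rightarrow> c x * d y)"
    unfolding gf_nth eq
    by (rule sum.UNION_disjoint) (use assms in \<open>auto simp: finite_fibres_def\<close>)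
  also have "\<dots> = (\<Sum>i=0..n. gf X w c $ i * gf Y v d $ (n - i))"
    by (simp add: gf_nth sum_product sum.cartesian_product)
  finally show "gf (X \<times> Y) (\<lambda>(x, y). w x + v y) (\<lambda>(x, y). c x * d y) $ n = (gf X w c * gf Y v d) $ n"
    by (simp add: fps_mult_nth)
qed

lemma finite_fibres_Times:
  assumes "finite_fibres X w" "finite_fibres Y v"
  shows "finite_fibres (X \<times> Y) (\<lambda>(x, y). w x + v y)"
  unfolding finite_fibres_def
proof
  fix n
  have "{p\<in>X \<times> Y. (case p of (x, y) \<Rightarrow> w x + v y) = n} 
      = (\<Union>i\<in>{0..n}. {x\<in>X. w x = i} \<times> {y\<in>Y. v y = n - i})"
    by auto
  then show "finite {p\<in>X \<times> Y. (case p of (x, y) \<Rightarrow> w x + v y) = n}"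
    using assms by (simp add: finite_fibres_def)
qed

lemma finite_fibres_subset: "finite_fibres Y w \<Longrightarrow> X \<subseteq> Y \<Longrightarrow> finite_fibres X w"
  unfolding finite_fibres_def
proof
  fix n assume "\<forall>n. finite {x\<in>Y. w x = n}" "X \<subseteq> Y"
  then have "finite {x\<in>Y. w x = n}" "{x\<in>X. w x = n} \<subseteq> {x\<in>Y. w x = n}" by auto
  then show "finite {x\<in>X. w x = n}" using finite_subset by blast
qed

lemma gf_Suc: "gf X (\<lambda>x. Suc (w x)) c = fps_X * gf X w c"
  by (rule fps_ext) (auto simp: gf_nth fps_X_mult_nth intro!: sum.cong)

text \<open>The substitution of q^3 for q.\<close>

abbreviation cub :: "complex fps \<Rightarrow> complex fps" where "cub f \<equiv> f oo fps_X ^ 3"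

lemma cub_nth: "cub f $ n = (if 3 dvd n then f $ (n div 3) else 0)"
proof -
  have "cub f $ n = (\<Sum>i\<in>{0..n}. if n = 3 * i then f $ i else 0)"
    unfolding fps_compose_nth by (rule sum.cong) (simp_all flip: power_mult add: fps_X_power_nth)
  also have "\<dots> = (\<Sum>i\<in>{0..n}. if i = n div 3 then if 3 dvd n then f $ i else 0 else 0)"
    by (rule sum.cong) auto
  finally show ?thesis by simp
qed

lemma gf_scale: "gf X (\<lambda>x. 3 * w x) c = cub (gf X w c)"
proof (rule fps_ext)
  fix n
  have "{x \<in> X. 3 * w x = n} = (if 3 dvd n then {x\<in>X. w x = n div 3} else {})"
    by auto
  then show "gf X (\<lambda>x. 3 * w x) c $ n = cub (gf X w c) $ n"
    by (simp add: gf_nth cub_nth)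
qed

section \<open>Fermionic states\<close>

text \<open>A finite set \<open>S\<close> records how a state differs from the vacuum, in which
  exactly the levels i <= 0 are filled: elements i >= 1 are particles of charge 1, elements i <= 0
  are holes of charge -1. The hole at 0 has energy 0.\<close>

definition sg :: "int \<Rightarrow> int" where "sg i = (if i \<ge> 1 then 1 else - 1)"

definition charge :: "int set \<Rightarrow> int" where "charge S = (\<Sum>i\<in>S. sg i)"

definition energy :: "int set \<Rightarrow> nat" where "energy S = (\<Sum>i\<in>S. nat \<bar>i\<bar>)"

text \<open>The filled levels are the symmetric difference of \<open>S\<close> and the vacuum.
  Shifting them by \<open>c\<close> and taking the difference with the vacuum again gives this
  formula.\<close>

definition transl :: "int \<Rightarrow> int set \<Rightarrow> int set" where
  "transl c S = {i. (i - c \<in> S) \<noteq> ((i \<le> 0) \<noteq> (i - c \<le> 0))}"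

lemma int_energy: "int (energy S) = (\<Sum>i\<in>S. sg i * i)"
  unfolding energy_def of_nat_sum by (rule sum.cong) (auto simp: sg_def)

lemma transl_transl: "transl c (transl d S) = transl (c + d) S"
  unfolding transl_def by (auto simp: algebra_simps)

lemma transl_0 [simp]: "transl 0 S = S"
  unfolding transl_def by auto

lemma finite_transl [simp]:
  assumes "finite S" shows "finite (transl c S)"
proof (rule finite_subset)
  show "transl c S \<subseteq> (\<lambda>i. i + c) ` S \<union> {- \<bar>c\<bar>..\<bar>c\<bar>}"
  proof
    fix i assume "i \<in> transl c S"
    then have "i - c \<in> S \<or> \<bar>i\<bar> \<le> \<bar>c\<bar>" unfolding transl_def by auto
    then show "i \<in> (\<lambda>i. i + c) ` S \<union> {- \<bar>c\<bar>..\<bar>c\<bar>}"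
      by (auto intro!: image_eqI[of _ _ "i - c"])
  qed
qed (use assms in simp)

text \<open>Every element other than 0 moves to i + 1 on its own side of the boundary, changing the
  energy by its charge. Level 0 crosses to 1: a hole at 0 disappears, and otherwise a particle
  appears at 1.\<close>

lemma transl_1:
  assumes "finite S"
  shows "charge (transl 1 S) = charge S + 1"
    and "int (energy (transl 1 S)) = int (energy S) + charge S + 1"
proof -
  let ?S = "S - {0}"
  have inj: "inj_on (\<lambda>i. i + 1) A" for A :: "int set" by (simp add: inj_on_def)
  have m: "A = B" if "\<And>i. i \<noteq> 1 \<Longrightarrow> i \<in> A \<longleftrightarrow> i \<in> B" "1 \<in> A \<longleftrightarrow> 1 \<in> B" for A B :: "int set"
    using that by (metis set_eqI)
  have s: "i \<in> (\<lambda>i. i + 1) ` A \<longleftrightarrow> i - 1 \<in> A" for i and A :: "int set"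
    by (auto intro!: image_eqI[of _ _ "i - 1"])
  have c: "charge ((\<lambda>i. i + 1) ` ?S) = charge ?S"
    unfolding charge_def
    by (subst sum.reindex[OF inj]) (auto simp: sg_def intro!: sum.cong split: if_splits)
  have e: "int (energy ((\<lambda>i. i + 1) ` ?S)) = int (energy ?S) + charge ?S"
    unfolding int_energy charge_def 
    by (subst sum.reindex[OF inj]) 
       (auto simp: sg_def sum.distrib[symmetric] algebra_simps intro!: sum.cong split: if_splits)
  have "charge (transl 1 S) = charge S + 1 \<and> 
    int (energy (transl 1 S)) = int (energy S) + charge S + 1"
  proof (cases "0 \<in> S")
    case True
    have "transl 1 S = (\<lambda>i. i + 1) ` ?S"
      by (rule m) (use True in \<open>auto simp: transl_def s\<close>)
    moreover have "charge S = charge ?S - 1" "int (energy S) = int (energy ?S)"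
      using True assms by (simp_all add: charge_def energy_def sum.remove[of S 0] sg_def)
    ultimately show ?thesis using c e by simp
  next
    case False
    have t: "transl 1 S = insert 1 ((\<lambda>i. i + 1) ` ?S)"
      by (rule m) (use False in \<open>auto simp: transl_def s\<close>)
    have n: "1 \<notin> (\<lambda>i. i + 1) ` ?S" by auto
    have "charge (transl 1 S) = 1 + charge ((\<lambda>i. i + 1) ` ?S)"
      "energy (transl 1 S) = 1 + energy ((\<lambda>i. i + 1) ` ?S)"
      unfolding charge_def energy_def t using n assms by (simp_all add: sg_def)
    moreover have "?S = S" using False by simp
    ultimately show ?thesis using c e by simp
  qed
  then show "charge (transl 1 S) = charge S + 1"
    and "int (energy (transl 1 S)) = int (energy S) + charge S + 1" by auto
qed

text \<open>Iterating the unit shift in both directions sums an arithmetic progression; the identity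
  is doubled to avoid halving \<open>c * (c + 1)\<close>.\<close>

lemma transl_charge_energy:
  assumes "finite S"
  shows "charge (transl c S) = charge S + c \<and>
    2 * int (energy (transl c S)) = 2 * int (energy S) + 2 * c * charge S + c * (c + 1)"
proof (induction c rule: int_induct[where k = 0])
  case base
  then show ?case by simp
next
  case (step1 i)
  have "transl (i + 1) S = transl 1 (transl i S)" by (simp add: transl_transl add.commute)
  with step1 show ?case using transl_1[of "transl i S"] assms by (simp add: algebra_simps)
next
  case (step2 i)
  have "transl i S = transl 1 (transl (i - 1) S)" by (simp add: transl_transl add.commute)
  with step2 show ?case using transl_1[of "transl (i - 1) S"] assms by (simp add: algebra_simps)
qed

definition neutral :: "int set set" where "neutral = {S. finite S \<and> charge S = 0}"

lemma transl_neutral: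
  assumes "finite S"
  shows "transl (- charge S) S \<in> neutral"
  using transl_charge_energy[OF assms, of "- charge S"] assms by (simp add: neutral_def)

lemma finite_fibres_energy: "finite_fibres {S. finite S} energy"
  unfolding finite_fibres_def
proof
  fix n
  have "S \<subseteq> {- int n..int n}" if "finite S" "energy S = n" for S
  proof
    fix i assume "i \<in> S"
    then have "nat \<bar>i\<bar> \<le> n"
      using that member_le_sum[of i S "\<lambda>i. nat \<bar>i\<bar>"] by (simp add: energy_def)
    then show "i \<in> {- int n..int n}" by auto
  qed
  then have "{S \<in> {S. finite S}. energy S = n} \<subseteq> Pow {- int n..int n}" by blast
  then show "finite {S \<in> {S. finite S}. energy S = n}" by (rule finite_subset) simp
qed

lemma finite_fibres_neutral: "k > 0 \<Longrightarrow> finite_fibres neutral (\<lambda>S. k * energy S)"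
  unfolding finite_fibres_def
proof
  fix n assume "k > (0::nat)"
  then have "{S \<in> neutral. k * energy S = n} \<subseteq> {S \<in> {S. finite S}. energy S = n div k}"
    by (auto simp: neutral_def)
  then show "finite {S \<in> neutral. k * energy S = n}"
    using finite_fibres_energy finite_subset unfolding finite_fibres_def by blast
qed

section \<open>Triples of states of total charge zero and their theta series\<close>

definition triples :: "(int set \<times> int set \<times> int set) set" where
  "triples = {(S, T, U). finite S \<and> finite T \<and> finite U \<and> charge S + charge T + charge U = 0}"

definition join :: "(int \<times> int) \<times> int set \<times> int set \<times> int set \<Rightarrow> int set \<times> int set \<times> int set" where
  "join = (\<lambda>((x, y), (S, T, U)). (transl x S, transl y T, transl (- x - y) U))"

text \<open>A state is determined by its charge and its translate of charge 0. The inverse reads off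
  two charges, the third being forced, and shifts each component back.\<close>

lemma bij_join: "bij_betw join (UNIV \<times> neutral \<times> neutral \<times> neutral) triples"
proof (rule bij_betw_byWitness[where f' = "\<lambda>(S, T, U). ((charge S, charge T),
     transl (- charge S) S, transl (- charge T) T, transl (- charge U) U)"])
  have *: "charge (transl c S) = c" if "S \<in> neutral" for c S
    using that transl_charge_energy[of S c] by (simp add: neutral_def)
  show "\<forall>p\<in>UNIV \<times> neutral \<times> neutral \<times> neutral. (case join p of (S, T, U) \<Rightarrow> ((charge S, charge T),
     transl (- charge S) S, transl (- charge T) T, transl (- charge U) U)) = p"
    by (auto simp: join_def * transl_transl)
  show "\<forall>p\<in>triples. join (case p of (S, T, U) \<Rightarrow> ((charge S, charge T),
     transl (- charge S) S, transl (- charge T) T, transl (- charge U) U)) = p"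
  proof (clarsimp simp: join_def triples_def transl_transl)
    fix S T U assume "charge S + charge T + charge U = 0"
    then have "- charge S - charge T - charge U = 0" by simp
    then show "transl (- charge S - charge T - charge U) U = U" by simp
  qed
  show "join ` (UNIV \<times> neutral \<times> neutral \<times> neutral) \<subseteq> triples"
    by (auto simp: join_def triples_def *) (auto simp: neutral_def)
  show "(\<lambda>(S, T, U). ((charge S, charge T), transl (- charge S) S, transl (- charge T) T,
      transl (- charge U) U)) ` triples \<subseteq> UNIV \<times> neutral \<times> neutral \<times> neutral"
    by (auto simp: triples_def transl_neutral)
qed

text \<open>Along \<open>join\<close> the weight separates into a part depending on the charges and
  the energies of three independent neutral states, so the series factors. The scale
  \<open>k\<close> is 1 for plain triples and 3 for merged ones.\<close>

lemma gf_triples: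
  assumes "k > 0" and ff: "finite_fibres UNIV t"
    and w: "\<And>x y S T U. S \<in> neutral \<Longrightarrow> T \<in> neutral \<Longrightarrow> U \<in> neutral \<Longrightarrow>
       w (transl x S, transl y T, transl (- x - y) U) = t (x, y) + k * (energy S + energy T + energy U)"
    and c: "\<And>x y S T U. S \<in> neutral \<Longrightarrow> T \<in> neutral \<Longrightarrow> U \<in> neutral \<Longrightarrow>
       c (transl x S, transl y T, transl (- x - y) U) = d (x, y)"
  shows "gf triples w c = gf UNIV t d * gf neutral (\<lambda>S. k * energy S) (\<lambda>_. 1) ^ 3"
proof -
  let ?e = "\<lambda>S. k * energy S"
  note n = finite_fibres_neutral[OF assms(1)]
  let ?g = "gf neutral ?e (\<lambda>_. 1)"
  let ?w2 = "\<lambda>(T, U). ?e T + ?e U"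
  let ?w3 = "\<lambda>(S, p). ?e S + ?w2 p"
  let ?c2 = "\<lambda>(T, U). 1 * 1"
  let ?c3 = "\<lambda>(S, p). 1 * ?c2 p"
  note n2 = finite_fibres_Times[OF n n]
  note n3 = finite_fibres_Times[OF n n2]
  have "gf triples w c = gf (UNIV \<times> neutral \<times> neutral \<times> neutral)
     (\<lambda>(q, r). t q + ?w3 r) (\<lambda>(q, r). d q * ?c3 r)"
    by (rule gf_reindex[OF bij_join]) (auto simp: join_def w c algebra_simps)
  also have "\<dots> = gf UNIV t d * gf (neutral \<times> neutral \<times> neutral) ?w3 ?c3"
    by (rule gf_Times[OF ff n3])
  also have "gf (neutral \<times> neutral \<times> neutral) ?w3 ?c3 = ?g * gf (neutral \<times> neutral) ?w2 ?c2"
    by (rule gf_Times[OF n n2])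
  also have "gf (neutral \<times> neutral) ?w2 ?c2 = ?g * ?g"
    by (rule gf_Times[OF n n])
  finally show ?thesis by (simp add: power3_eq_cube mult.assoc)
qed

abbreviation one_wt :: "'s \<Rightarrow> complex" where "one_wt \<equiv> \<lambda>_. 1"

definition Q :: "complex fps" where "Q = gf neutral energy one_wt"

definition nrm :: "int \<times> int \<Rightarrow> nat" where "nrm = (\<lambda>(x, y). nat (x\<^sup>2 + x * y + y\<^sup>2))"

text \<open>The norm form on the coset of (1, 0) modulo 3, lowered by 1 and divided by 3; see
  \<open>nrm_nrm3\<close>.\<close>

definition nrm3 :: "int \<times> int \<Rightarrow> nat" where
  "nrm3 = (\<lambda>(x, y). nat (3 * (x\<^sup>2 + x * y + y\<^sup>2) + 2 * x + y))"

definition theta_a :: "complex fps" where "theta_a = gf UNIV nrm one_wt"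

text \<open>Borwein's c(q) without its factor 3 q^(1/3).\<close>

definition theta_c :: "complex fps" where "theta_c = gf UNIV nrm3 one_wt"

text \<open>Twice the form is a sum of three squares, so \<open>nat\<close> truncates
  nothing.\<close>

lemma int_nrm: "int (nrm (x, y)) = x\<^sup>2 + x * y + y\<^sup>2"
proof -
  have "2 * (x\<^sup>2 + x * y + y\<^sup>2) = x\<^sup>2 + y\<^sup>2 + (x + y)\<^sup>2" by algebra
  then have "x\<^sup>2 + x * y + y\<^sup>2 \<ge> 0"
    by (smt (verit) zero_le_power2)
  then show ?thesis by (simp add: nrm_def)
qed

lemma int_nrm3: "int (nrm3 (x, y)) = 3 * (x\<^sup>2 + x * y + y\<^sup>2) + 2 * x + y"
  and nrm_nrm3: "nrm (3 * x + 1, 3 * y) = Suc (3 * nrm3 (x, y))"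
proof -
  have e: "int (nrm (3 * x + 1, 3 * y)) = 3 * (3 * (x\<^sup>2 + x * y + y\<^sup>2) + 2 * x + y) + 1"
    unfolding int_nrm by algebra
  moreover have "0 \<le> t" if "0 \<le> 3 * t + 1" for t :: int using that by linarith
  ultimately have "3 * (x\<^sup>2 + x * y + y\<^sup>2) + 2 * x + y \<ge> 0"
    by (metis of_nat_0_le_iff)
  then show *: "int (nrm3 (x, y)) = 3 * (x\<^sup>2 + x * y + y\<^sup>2) + 2 * x + y" by (simp add: nrm3_def)
  have "int (nrm (3 * x + 1, 3 * y)) = int (Suc (3 * nrm3 (x, y)))"
    unfolding e by (simp add: *)
  then show "nrm (3 * x + 1, 3 * y) = Suc (3 * nrm3 (x, y))" by (simp only: of_nat_eq_iff)
qed

lemma finite_fibres_nrm: "finite_fibres UNIV nrm"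
  unfolding finite_fibres_def
proof
  fix n
  have "{p \<in> UNIV. nrm p = n} \<subseteq> {- 2 * int n..2 * int n} \<times> {- 2 * int n..2 * int n}"
  proof
    fix p assume "p \<in> {p \<in> UNIV. nrm p = n}"
    moreover obtain x y where p: "p = (x, y)" by fastforce
    ultimately have n: "int n = x\<^sup>2 + x * y + y\<^sup>2" by (auto simp flip: int_nrm)
    have "2 * (x\<^sup>2 + x * y + y\<^sup>2) = x\<^sup>2 + y\<^sup>2 + (x + y)\<^sup>2" by algebra
    then have "x\<^sup>2 \<le> 2 * int n" "y\<^sup>2 \<le> 2 * int n"
      unfolding n by (smt (verit) zero_le_power2)+
    moreover have "\<bar>z\<bar> \<le> z\<^sup>2" for z :: int
    proof -
      have "0 \<le> \<bar>z\<bar> * (\<bar>z\<bar> - 1)" by (cases "z = 0") (auto intro!: mult_nonneg_nonneg)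
      then show ?thesis by (simp add: power2_eq_square algebra_simps)
    qed
    ultimately have "\<bar>x\<bar> \<le> 2 * int n" "\<bar>y\<bar> \<le> 2 * int n" by (meson order_trans)+
    then show "p \<in> {- 2 * int n..2 * int n} \<times> {- 2 * int n..2 * int n}" by (auto simp: p)
  qed
  then show "finite {p \<in> UNIV. nrm p = n}" by (rule finite_subset) simp
qed

lemma finite_fibres_nrm3: "finite_fibres UNIV nrm3"
  unfolding finite_fibres_def
proof
  fix n
  let ?h = "\<lambda>(x, y). (3 * x + 1, 3 * y)"
  have "?h ` {p \<in> UNIV. nrm3 p = n} \<subseteq> {p \<in> UNIV. nrm p = Suc (3 * n)}"
    by (auto simp: nrm_nrm3)
  then have "finite (?h ` {p \<in> UNIV. nrm3 p = n})"
    using finite_fibres_nrm finite_subset unfolding finite_fibres_def by blast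
  moreover have "inj_on ?h {p \<in> UNIV. nrm3 p = n}" by (auto simp: inj_on_def)
  ultimately show "finite {p \<in> UNIV. nrm3 p = n}" by (rule finite_imageD)
qed

lemma energy_transl:
  assumes "S \<in> neutral"
  shows "2 * int (energy (transl c S)) = 2 * int (energy S) + c * (c + 1)"
    and "charge (transl c S) = c"
  using transl_charge_energy[of S c] assms by (auto simp: neutral_def)

text \<open>The charges sum to 0, so in the shift energies c (c + 1) / 2 the linear parts cancel;
  half the sum of the three squares is the norm form.\<close>

lemma energy_triple:
  assumes "S \<in> neutral" "T \<in> neutral" "U \<in> neutral"
  shows "energy (transl x S) + energy (transl y T) + energy (transl (- x - y) U) 
    = nrm (x, y) + (energy S + energy T + energy U)"
proof -
  have "2 * (int (energy (transl x S)) + int (energy (transl y T)) + int (energy (transl (- x - y) U)))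
    = 2 * (int (nrm (x, y)) + (int (energy S) + int (energy T) + int (energy U)))"
    unfolding int_nrm distrib_left using assms by (simp add: energy_transl) algebra
  then show ?thesis
    by (simp only: mult_cancel_left of_nat_add [symmetric] of_nat_eq_iff) simp
qed

section \<open>Frobenius partitions as triples of states\<close>

lemma gf_triples_energy:
  "gf triples (\<lambda>(S, T, U). energy S + energy T + energy U) one_wt = theta_a * Q ^ 3"
proof -
  have "gf triples (\<lambda>(S, T, U). energy S + energy T + energy U) one_wt
     = gf UNIV nrm one_wt * gf neutral (\<lambda>S. 1 * energy S) one_wt ^ 3"
    by (rule gf_triples[OF _ finite_fibres_nrm]) (simp_all add: energy_triple)
  then show ?thesis by (simp add: theta_a_def Q_def)
qed

definition component :: "nat \<Rightarrow> 'a \<times> 'a \<times> 'a \<Rightarrow> 'a" where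
  "component c = (\<lambda>(x, y, z). if c = 1 then x else if c = 2 then y else z)"

text \<open>A particle at level a + 1 is an upper entry a, a hole at level -b a lower entry b. The
  energies a + 1 and b then account for the summand r in the size of an array.\<close>

definition upper :: "int set \<times> int set \<times> int set \<Rightarrow> (nat \<times> nat) set" where
  "upper p = {(a, c). c \<in> {1..3} \<and> int a + 1 \<in> component c p}"

definition lower :: "int set \<times> int set \<times> int set \<Rightarrow> (nat \<times> nat) set" where
  "lower p = {(b, c). c \<in> {1..3} \<and> - int b \<in> component c p}"

text \<open>Stated for arbitrary \<open>f\<close>: a constant gives the row lengths,
  \<open>Suc\<close> and the identity give the size.\<close>

lemma sum_upper_lower:
  fixes f :: "nat \<Rightarrow> nat"
  assumes "finite S" "finite T" "finite U"
  shows "finite (upper (S, T, U))" "finite (lower (S, T, U))"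
    "(\<Sum>p\<in>upper (S, T, U). f (fst p)) = (\<Sum>i\<in>{i\<in>S. i \<ge> 1}. f (nat (i - 1))) 
      + (\<Sum>i\<in>{i\<in>T. i \<ge> 1}. f (nat (i - 1))) + (\<Sum>i\<in>{i\<in>U. i \<ge> 1}. f (nat (i - 1)))"
    "(\<Sum>p\<in>lower (S, T, U). f (fst p)) = (\<Sum>i\<in>{i\<in>S. \<not> i \<ge> 1}. f (nat (- i))) 
      + (\<Sum>i\<in>{i\<in>T. \<not> i \<ge> 1}. f (nat (- i))) + (\<Sum>i\<in>{i\<in>U. \<not> i \<ge> 1}. f (nat (- i)))"
proof -
  let ?c = "\<lambda>c. component c (S, T, U)"
  have fin: "finite (?c c)" for c using assms by (simp add: component_def)
  let ?A = "SIGMA c:{1..3::nat}. {i\<in>?c c. i \<ge> 1}"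
  let ?B = "SIGMA c:{1..3::nat}. {i\<in>?c c. \<not> i \<ge> 1}"
  have up: "upper (S, T, U) = (\<lambda>(c, i). (nat (i - 1), c)) ` ?A"
  proof safe
    fix a c assume "(a, c) \<in> upper (S, T, U)"
    then show "(a, c) \<in> (\<lambda>(c, i). (nat (i - 1), c)) ` ?A"
      by (intro image_eqI[of _ _ "(c, int a + 1)"]) (auto simp: upper_def)
  qed (auto simp: upper_def)
  have lo: "lower (S, T, U) = (\<lambda>(c, i). (nat (- i), c)) ` ?B"
  proof safe
    fix a c assume "(a, c) \<in> lower (S, T, U)"
    then show "(a, c) \<in> (\<lambda>(c, i). (nat (- i), c)) ` ?B"
      by (intro image_eqI[of _ _ "(c, - int a)"]) (auto simp: lower_def)
  qed (auto simp: lower_def)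
  have iA: "inj_on (\<lambda>(c, i). (nat (i - 1), c)) ?A" and iB: "inj_on (\<lambda>(c, i). (nat (- i), c)) ?B"
    by (auto simp: inj_on_def)
  have "finite ?A" "finite ?B" using fin by (intro finite_SigmaI; simp)+
  then show "finite (upper (S, T, U))" "finite (lower (S, T, U))"
    unfolding up lo by simp_all
  have c3: "{1..3::nat} = {1, 2, 3}" by auto
  have "(\<Sum>p\<in>upper (S, T, U). f (fst p)) = (\<Sum>(c, i)\<in>?A. f (nat (i - 1)))"
    unfolding up by (subst sum.reindex[OF iA]) (simp add: case_prod_beta o_def)
  also have "\<dots> = (\<Sum>c\<in>{1..3}. \<Sum>i\<in>{i\<in>?c c. i \<ge> 1}. f (nat (i - 1)))"
    using fin by (subst sum.Sigma) simp_all
  finally show "(\<Sum>p\<in>upper (S, T, U). f (fst p)) = (\<Sum>i\<in>{i\<in>S. i \<ge> 1}. f (nat (i - 1))) 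
      + (\<Sum>i\<in>{i\<in>T. i \<ge> 1}. f (nat (i - 1))) + (\<Sum>i\<in>{i\<in>U. i \<ge> 1}. f (nat (i - 1)))"
    unfolding c3 by (simp add: component_def)
  have "(\<Sum>p\<in>lower (S, T, U). f (fst p)) = (\<Sum>(c, i)\<in>?B. f (nat (- i)))"
    unfolding lo by (subst sum.reindex[OF iB]) (simp add: case_prod_beta o_def)
  also have "\<dots> = (\<Sum>c\<in>{1..3}. \<Sum>i\<in>{i\<in>?c c. \<not> i \<ge> 1}. f (nat (- i)))"
    using fin by (subst sum.Sigma) simp_all
  finally show "(\<Sum>p\<in>lower (S, T, U). f (fst p)) = (\<Sum>i\<in>{i\<in>S. \<not> i \<ge> 1}. f (nat (- i))) 
      + (\<Sum>i\<in>{i\<in>T. \<not> i \<ge> 1}. f (nat (- i))) + (\<Sum>i\<in>{i\<in>U. \<not> i \<ge> 1}. f (nat (- i)))"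
    unfolding c3 by (simp add: component_def)
qed

lemma split_pos:
  fixes f :: "int \<Rightarrow> 'a::comm_monoid_add"
  assumes "finite S"
  shows "sum f S = sum f {i\<in>S. i \<ge> 1} + sum f {i\<in>S. \<not> i \<ge> 1}"
proof -
  have "S = {i\<in>S. i \<ge> 1} \<union> {i\<in>S. \<not> i \<ge> 1}" by auto
  then show ?thesis
    by (subst (1) \<open>S = _\<close>) (rule sum.union_disjoint, use assms in auto)
qed

lemma charge_split:
  assumes "finite S"
  shows "charge S = int (card {i\<in>S. i \<ge> 1}) - int (card {i\<in>S. \<not> i \<ge> 1})"
  unfolding charge_def split_pos[OF assms] by (simp add: sg_def)

lemma energy_split:
  assumes "finite S"
  shows "energy S = (\<Sum>i\<in>{i\<in>S. i \<ge> 1}. Suc (nat (i - 1))) + (\<Sum>i\<in>{i\<in>S. \<not> i \<ge> 1}. nat (- i))"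
  unfolding energy_def split_pos[OF assms] by (intro arg_cong2[of _ _ _ _ "(+)"] sum.cong) auto

lemma card_upper_lower:
  assumes "finite S" "finite T" "finite U"
  shows "int (card (upper (S, T, U))) - int (card (lower (S, T, U))) = charge S + charge T + charge U"
    and "(\<Sum>p\<in>upper (S, T, U). Suc (fst p)) + (\<Sum>p\<in>lower (S, T, U). fst p) 
      = energy S + energy T + energy U"
proof -
  show "int (card (upper (S, T, U))) - int (card (lower (S, T, U))) = charge S + charge T + charge U"
    using sum_upper_lower(3,4)[OF assms, of "\<lambda>_. 1"] assms by (simp add: charge_split)
  show "(\<Sum>p\<in>upper (S, T, U). Suc (fst p)) + (\<Sum>p\<in>lower (S, T, U). fst p) 
      = energy S + energy T + energy U"
    using sum_upper_lower(3)[OF assms, of "Suc"] sum_upper_lower(4)[OF assms, of "\<lambda>x. x"] assms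
    by (simp add: energy_split)
qed

definition coloured_sets :: "((nat \<times> nat) set \<times> (nat \<times> nat) set) set" where
  "coloured_sets = {(A, B). finite A \<and> finite B \<and> A \<subseteq> colored_ints 3 \<and> B \<subseteq> colored_ints 3 \<and> card A = card B}"

text \<open>Total charge zero means as many particles as holes, that is, rows of equal
  length.\<close>

lemma bij_coloured_sets: "bij_betw (\<lambda>p. (upper p, lower p)) triples coloured_sets"
proof (rule bij_betw_byWitness)
  let ?s = "\<lambda>A B c. {i. i \<ge> 1 \<and> (nat (i - 1), c) \<in> A \<or> i \<le> 0 \<and> (nat (- i), c) \<in> B}"
  let ?r = "\<lambda>(A, B). (?s A B 1, ?s A B 2, ?s A B 3)"
  have *: "?s (upper p) (lower p) c = component c p" if "c \<in> {1..3}" for p c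
    using that by (auto simp: upper_def lower_def)
  show "\<forall>p\<in>triples. ?r (upper p, lower p) = p"
    unfolding prod.case using * by (auto simp: component_def)
  have comp: "component c (?r (A, B)) = ?s A B c" if "c \<in> {1..3}" for A B c
  proof -
    have "c = 1 \<or> c = 2 \<or> c = 3" using that by auto
    then show ?thesis by (elim disjE) (simp_all add: component_def)
  qed
  have "upper (?r (A, B)) = A" if "A \<subseteq> colored_ints 3" for A B
    using that comp by (auto simp: upper_def colored_ints_def subset_iff)
  moreover have "lower (?r (A, B)) = B" if "B \<subseteq> colored_ints 3" for A B
    using that comp by (auto simp: lower_def colored_ints_def subset_iff)
  ultimately have inv: "upper (?r (A, B)) = A \<and> lower (?r (A, B)) = B" 
    if "(A, B) \<in> coloured_sets" for A B
    using that by (auto simp: coloured_sets_def)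
  show "\<forall>q\<in>coloured_sets. (upper (?r q), lower (?r q)) = q"
  proof
    fix q assume q: "q \<in> coloured_sets"
    obtain A B where "q = (A, B)" by (cases q)
    with q show "(upper (?r q), lower (?r q)) = q" using inv[of A B] by simp
  qed
  show "(\<lambda>p. (upper p, lower p)) ` triples \<subseteq> coloured_sets"
  proof clarify
    fix S T U assume "(S, T, U) \<in> triples"
    then have f: "finite S" "finite T" "finite U" "charge S + charge T + charge U = 0"
      by (auto simp: triples_def)
    show "(upper (S, T, U), lower (S, T, U)) \<in> coloured_sets"
      using sum_upper_lower(1,2)[OF f(1-3)] card_upper_lower(1)[OF f(1-3)] f(4)
      by (simp add: coloured_sets_def) (auto simp: upper_def lower_def colored_ints_def)
  qed
  show "?r ` coloured_sets \<subseteq> triples"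
  proof clarify
    fix A B assume AB: "(A, B) \<in> coloured_sets"
    have fin: "finite (?s A B c)" for c
    proof (rule finite_subset)
      show "?s A B c \<subseteq> (\<lambda>p. int (fst p) + 1) ` A \<union> (\<lambda>p. - int (fst p)) ` B"
        by (auto intro!: image_eqI[of _ _ "(_, c)"])
    qed (use AB in \<open>simp add: coloured_sets_def\<close>)
    have "charge (?s A B 1) + charge (?s A B 2) + charge (?s A B 3) = int (card A) - int (card B)"
      using card_upper_lower(1)[OF fin fin fin, of 1 2 3] inv[OF AB] by simp
    then show "(?s A B 1, ?s A B 2, ?s A B 3) \<in> triples"
      unfolding triples_def using fin AB by (simp add: coloured_sets_def)
  qed
qed

lemma colored_less_eq: "colored_less = (<)"
  by (intro ext) (auto simp: colored_less_iff less_prod_def split: prod.splits)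

text \<open>A strictly decreasing row is determined by its set of entries; \<open>rev\<close> turns
  the increasing \<open>sorted_list_of_set\<close> into that row.\<close>

lemma bij_sorted_lists:
  "bij_betw (\<lambda>(as, bs). (set as, set bs)) 
     (\<Union>n. gen_frob_partitions 3 n) coloured_sets"
proof (rule bij_betw_byWitness[where f' = "\<lambda>(A, B). (rev (sorted_list_of_set A), rev (sorted_list_of_set B))"])
  have s: "rev (sorted_list_of_set (set xs)) = xs" if "sorted_wrt (\<lambda>x y. y < x) xs" for xs :: "(nat \<times> nat) list"
  proof -
    have "sorted_wrt (<) (rev xs)" using that by (simp add: sorted_wrt_rev)
    then have "sorted_list_of_set (set (rev xs)) = rev xs"
      by (metis sorted_list_of_set.idem_if_sorted_distinct strict_sorted_iff)
    then show ?thesis by simp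
  qed
  then show "\<forall>p\<in>\<Union>n. gen_frob_partitions 3 n. (case case p of (as, bs) \<Rightarrow> (set as, set bs) of
     (A, B) \<Rightarrow> (rev (sorted_list_of_set A), rev (sorted_list_of_set B))) = p"
    by (auto simp: gen_frob_partitions_def colored_less_eq)
  show "\<forall>q\<in>coloured_sets. (case case q of (A, B) \<Rightarrow> (rev (sorted_list_of_set A), rev (sorted_list_of_set B)) of
     (as, bs) \<Rightarrow> (set as, set bs)) = q"
    by (auto simp: coloured_sets_def)
  have d: "distinct xs" if "sorted_wrt (\<lambda>x y. y < x) xs" for xs :: "(nat \<times> nat) list"
    using s[OF that] by (metis distinct_rev sorted_list_of_set.distinct_sorted_key_list_of_set)
  show "(\<lambda>(as, bs). (set as, set bs)) ` (\<Union>n. gen_frob_partitions 3 n) \<subseteq> coloured_sets"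
    by (auto simp: gen_frob_partitions_def colored_less_eq coloured_sets_def d distinct_card)
  show "(\<lambda>(A, B). (rev (sorted_list_of_set A), rev (sorted_list_of_set B))) ` coloured_sets
      \<subseteq> (\<Union>n. gen_frob_partitions 3 n)"
    by (auto simp: gen_frob_partitions_def colored_less_eq coloured_sets_def sorted_wrt_rev)
qed

lemma gen_frob_weight:
  assumes "(as, bs) \<in> gen_frob_partitions 3 n"
  shows "(\<Sum>p\<in>set as. Suc (fst p)) + (\<Sum>p\<in>set bs. fst p) = n"
proof -
  have len: "length as = length bs" 
    and srt: "sorted_wrt (\<lambda>x y. y < x) as" "sorted_wrt (\<lambda>x y. y < x) bs"
    and n: "n = length as + (\<Sum>i<length as. fst (as ! i) + fst (bs ! i))"
    using assms by (auto simp: gen_frob_partitions_def colored_less_eq)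
  have d: "distinct xs" if "sorted_wrt (\<lambda>x y. y < x) xs" for xs :: "(nat \<times> nat) list"
    using that by (induction xs) auto
  have e: "(\<Sum>p\<in>set xs. fst p) = (\<Sum>i<length xs. fst (xs ! i))" 
    if "distinct xs" for xs :: "(nat \<times> nat) list"
    using sum_list_distinct_conv_sum_set[OF that, of fst] 
    by (simp add: sum_list_sum_nth lessThan_atLeast0)
  have "(\<Sum>p\<in>set as. Suc (fst p)) = length as + (\<Sum>p\<in>set as. fst p)"
    using d[OF srt(1)] by (simp add: sum_Suc distinct_card)
  then show ?thesis
    using n len e[OF d[OF srt(1)]] e[OF d[OF srt(2)]] by (simp add: sum.distrib)
qed

theorem cphi_3_gf: "Abs_fps (\<lambda>n. of_nat (cphi 3 n)) = theta_a * Q ^ 3"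
proof -
  let ?w = "\<lambda>(A, B). (\<Sum>p\<in>A. Suc (fst p)) + (\<Sum>p\<in>B. fst p)"
  let ?G = "\<Union>n. gen_frob_partitions 3 n"
  have "gf coloured_sets ?w one_wt = gf triples (\<lambda>(S, T, U). energy S + energy T + energy U) one_wt"
    by (rule gf_reindex[OF bij_coloured_sets]) (auto simp: triples_def card_upper_lower(2))
  moreover have "gf coloured_sets ?w one_wt = gf ?G (\<lambda>(as, bs). ?w (set as, set bs)) one_wt"
    by (rule gf_reindex[OF bij_sorted_lists]) auto
  moreover have "gf ?G (\<lambda>(as, bs). ?w (set as, set bs)) one_wt = Abs_fps (\<lambda>n. of_nat (cphi 3 n))"
  proof (rule fps_ext)
    fix n
    have "{p\<in>?G. (case p of (as, bs) \<Rightarrow> ?w (set as, set bs)) = n} = gen_frob_partitions 3 n"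
      using gen_frob_weight by auto
    then show "gf ?G (\<lambda>(as, bs). ?w (set as, set bs)) one_wt $ n = Abs_fps (\<lambda>n. of_nat (cphi 3 n)) $ n"
      by (simp add: gf_nth cphi_def)
  qed
  ultimately show ?thesis using gf_triples_energy by simp
qed

section \<open>Merging three states into one\<close>

text \<open>With the offsets 0, 1, 2 the positive levels come exactly from positive levels, so signs
  are kept and charges add.\<close>

definition merge :: "int set \<times> int set \<times> int set \<Rightarrow> int set" where
  "merge = (\<lambda>(S, T, U). {i. \<exists>k. i = 3 * k \<and> k \<in> S \<or> i = 3 * k - 1 \<and> k \<in> T \<or> i = 3 * k - 2 \<and> k \<in> U})"

lemma merge_charge_energy:
  assumes "finite S" "finite T" "finite U"
  shows "finite (merge (S, T, U))"
    and "charge (merge (S, T, U)) = charge S + charge T + charge U"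
    and "int (energy (merge (S, T, U))) = 
      3 * (int (energy S) + int (energy T) + int (energy U)) - charge T - 2 * charge U"
proof -
  let ?S = "(\<lambda>k. 3 * k) ` S" and ?T = "(\<lambda>k. 3 * k - 1) ` T" and ?U = "(\<lambda>k. 3 * k - 2) ` U"
  have m: "merge (S, T, U) = ?S \<union> (?T \<union> ?U)"
    unfolding merge_def by auto
  have d: "?S \<inter> (?T \<union> ?U) = {}" "?T \<inter> ?U = {}"
    by (auto, presburger+)
  have f: "finite ?S" "finite ?T" "finite ?U" using assms by auto
  then show "finite (merge (S, T, U))" unfolding m by simp
  have inj: "inj_on (\<lambda>k. 3 * k - c) A" for A and c :: int by (simp add: inj_on_def)
  have eq: "sum g (merge (S, T, U)) = (\<Sum>k\<in>S. g (3 * k)) + ((\<Sum>k\<in>T. g (3 * k - 1)) + (\<Sum>k\<in>U. g (3 * k - 2)))"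
    for g :: "int \<Rightarrow> int"
    unfolding m using f d inj[of 0 S] inj[of 1 T] inj[of 2 U] 
    by (simp add: sum.union_disjoint sum.reindex)
  have s: "sg (3 * k) = sg k" "sg (3 * k - 1) = sg k" "sg (3 * k - 2) = sg k" for k
    by (auto simp: sg_def)
  show "charge (merge (S, T, U)) = charge S + charge T + charge U"
    unfolding charge_def eq s by simp
  show "int (energy (merge (S, T, U))) = 
      3 * (int (energy S) + int (energy T) + int (energy U)) - charge T - 2 * charge U"
    unfolding int_energy charge_def eq s 
    by (simp add: right_diff_distrib sum_subtractf sum_distrib_left sum_distrib_right mult.left_commute mult.commute)
qed

lemma bij_merge: "bij_betw merge triples neutral"
proof (rule bij_betw_byWitness)
  let ?r = "\<lambda>M. ({k. 3 * k \<in> M}, {k. 3 * k - 1 \<in> M}, {k. 3 * k - 2 \<in> M})"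
  have ne: "3 * k \<noteq> 3 * l - 1" "3 * k \<noteq> 3 * l - 2" "3 * k - 1 \<noteq> 3 * l - 2" 
    "3 * k - 1 \<noteq> 3 * l" "3 * k - 2 \<noteq> 3 * l" "3 * k - 2 \<noteq> 3 * l - 1" for k l :: int
    by presburger+
  have merge_r: "merge (?r M) = M" for M
  proof (rule set_eqI)
    fix i :: int
    have "(\<exists>k. i = 3 * k) \<or> (\<exists>k. i = 3 * k - 1) \<or> (\<exists>k. i = 3 * k - 2)" by presburger
    then show "i \<in> merge (?r M) \<longleftrightarrow> i \<in> M"
      by (elim disjE exE) (simp_all add: merge_def ne)
  qed
  then show "\<forall>M\<in>neutral. merge (?r M) = M" by blast
  have "3 * k \<in> merge (S, T, U) \<longleftrightarrow> k \<in> S" "3 * k - 1 \<in> merge (S, T, U) \<longleftrightarrow> k \<in> T"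
    "3 * k - 2 \<in> merge (S, T, U) \<longleftrightarrow> k \<in> U" for k S T U
    by (simp_all add: merge_def ne)
  then show "\<forall>p\<in>triples. ?r (merge p) = p" by auto
  show "merge ` triples \<subseteq> neutral"
    using merge_charge_energy by (auto simp: triples_def neutral_def)
  show "?r ` neutral \<subseteq> triples"
  proof
    fix p assume "p \<in> ?r ` neutral"
    then obtain M where M: "p = ?r M" "finite M" "charge M = 0" by (auto simp: neutral_def)
    have "finite {k. 3 * k - c \<in> M}" for c :: int
      using finite_vimageI[OF M(2), of "\<lambda>k. 3 * k - c"] by (simp add: inj_def vimage_def)
    from this[of 0] this[of 1] this[of 2] show "p \<in> triples"
      using merge_charge_energy(2)[of "{k. 3 * k \<in> M}" "{k. 3 * k - 1 \<in> M}" "{k. 3 * k - 2 \<in> M}"] 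
        merge_r[of M] M
      by (simp add: triples_def)
  qed
qed

text \<open>A neutral state is counted through its three interleaved components. At charges x, y, -x
  - y the linear energy correction of \<open>merge\<close> is 2 x + y, which turns 3 times
  \<open>nrm\<close> into \<open>nrm3\<close>.\<close>

lemma Q_theta_c: "Q = theta_c * cub Q ^ 3"
proof -
  have "Q = gf triples (\<lambda>p. energy (merge p)) one_wt"
    unfolding Q_def by (rule gf_reindex[OF bij_merge]) auto
  also have "\<dots> = gf UNIV nrm3 one_wt * gf neutral (\<lambda>S. 3 * energy S) one_wt ^ 3"
  proof (rule gf_triples[OF _ finite_fibres_nrm3])
    fix x y S T U assume n: "S \<in> neutral" "T \<in> neutral" "U \<in> neutral"
    then have f: "finite (transl x S)" "finite (transl y T)" "finite (transl (- x - y) U)"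
      by (auto simp: neutral_def)
    have "int (energy (transl x S)) + int (energy (transl y T)) + int (energy (transl (- x - y) U))
       = int (nrm (x, y)) + int (energy S) + int (energy T) + int (energy U)"
      using energy_triple[OF n, of x y] by linarith
    then have "int (energy (merge (transl x S, transl y T, transl (- x - y) U)))
       = int (nrm3 (x, y) + 3 * (energy S + energy T + energy U))"
      unfolding merge_charge_energy(3)[OF f] using n by (simp add: energy_transl(2) int_nrm3 int_nrm)
    then show "energy (merge (transl x S, transl y T, transl (- x - y) U)) =
       nrm3 (x, y) + 3 * (energy S + energy T + energy U)"
      by (simp only: of_nat_eq_iff)
  qed simp_all
  finally show ?thesis unfolding theta_c_def gf_scale Q_def[symmetric] .
qed

section \<open>Cancellation at a cube root of unity\<close>

lemma sum_Pow_insert: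
  assumes "finite I" "i \<notin> I"
  shows "(\<Sum>S\<in>Pow (insert i I). f S) = (\<Sum>S\<in>Pow I. f S + f (insert i S))"
proof -
  have "inj_on (insert i) (Pow I)" using assms by (auto simp: inj_on_def)
  moreover have "Pow I \<inter> insert i ` Pow I = {}" using assms by auto
  ultimately show ?thesis
    unfolding Pow_insert using assms
    by (simp add: sum.union_disjoint sum.reindex sum.distrib)
qed

text \<open>This is the product over \<open>i\<close> of (1 + z)(1 + w z)(1 + w^2 z) = 1 + z^3,
  where z marks \<open>v i\<close> and the functional \<open>g\<close> replaces a formal variable.
  The induction needs all \<open>g\<close>, since its hypothesis is also applied to the shift of
  \<open>g\<close> by three copies of \<open>v i\<close>.\<close>

lemma cube_root_cancellation:
  fixes g :: "'m::comm_monoid_add \<Rightarrow> complex" and v :: "'i \<Rightarrow> 'm"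
  assumes "finite I" and w: "\<And>i. i \<in> I \<Longrightarrow> 1 + w i + (w i)\<^sup>2 = 0"
  shows "(\<Sum>S\<in>Pow I. \<Sum>T\<in>Pow I. \<Sum>U\<in>Pow I. prod w T * (prod w U)\<^sup>2 * g (sum v S + sum v T + sum v U))
    = (\<Sum>S\<in>Pow I. g (sum v S + sum v S + sum v S))"
  using assms
proof (induction I arbitrary: g rule: finite_induct)
  case empty
  then show ?case by simp
next
  case (insert i I)
  let ?Z = "\<lambda>g. \<Sum>S\<in>Pow I. \<Sum>T\<in>Pow I. \<Sum>U\<in>Pow I. prod w T * (prod w U)\<^sup>2 * g (sum v S + sum v T + sum v U)"
  have w: "1 + w i + (w i)\<^sup>2 = 0" using insert by simp
  have "w i ^ 3 - 1 = (w i - 1) * (1 + w i + (w i)\<^sup>2)" by algebra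
  then have w3: "w i ^ 3 = 1" using w by simp
  have ins: "sum v (insert i S) = v i + sum v S" "prod w (insert i S) = w i * prod w S" if "S \<in> Pow I" for S
    using that insert.hyps finite_subset[of S I] by (auto intro: sum.insert prod.insert)
  let ?v2 = "v i + v i" and ?v3 = "v i + v i + v i"
  \<comment> \<open>The eight terms list the memberships of \<open>i\<close> in S, T, U. One
    membership carries 1 + w + w^2 = 0 in total, two carry w + w^2 + w^3 = 0, and all three carry
    w^3 = 1.\<close>
  have cmb: "x * g m + x * ((w i)\<^sup>2) * g (v i + m) + (x * w i * g (v i + m) + x * (w i * (w i)\<^sup>2) * g (?v2 + m))
     + (x * g (v i + m) + x * ((w i)\<^sup>2) * g (?v2 + m) + (x * w i * g (?v2 + m) + x * (w i * (w i)\<^sup>2) * g (?v3 + m)))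
    = x * g m + x * g (?v3 + m)" for x m
  proof -
    have "x * g m + x * ((w i)\<^sup>2) * g (v i + m) + (x * w i * g (v i + m) + x * (w i * (w i)\<^sup>2) * g (?v2 + m))
     + (x * g (v i + m) + x * ((w i)\<^sup>2) * g (?v2 + m) + (x * w i * g (?v2 + m) + x * (w i * (w i)\<^sup>2) * g (?v3 + m)))
     = x * g m + x * (1 + w i + (w i)\<^sup>2) * g (v i + m) + x * (w i ^ 3 + w i + (w i)\<^sup>2) * g (?v2 + m) + x * w i ^ 3 * g (?v3 + m)"
      by (simp add: algebra_simps power2_eq_square power3_eq_cube)
    then show ?thesis by (simp add: w w3)
  qed
  have "(\<Sum>S\<in>Pow (insert i I). \<Sum>T\<in>Pow (insert i I). \<Sum>U\<in>Pow (insert i I). 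
      prod w T * (prod w U)\<^sup>2 * g (sum v S + sum v T + sum v U))
    = (\<Sum>S\<in>Pow I. \<Sum>T\<in>Pow I. \<Sum>U\<in>Pow I. prod w T * (prod w U)\<^sup>2 * g (sum v S + sum v T + sum v U)
        + prod w T * (prod w U)\<^sup>2 * g (?v3 + (sum v S + sum v T + sum v U)))"
    unfolding sum_Pow_insert[OF insert.hyps] sum.distrib [symmetric]
  proof (intro sum.cong refl, goal_cases)
    case (1 S T U)
    show ?case 
      unfolding cmb[symmetric] ins[OF 1(1)] ins[OF 1(2)] ins[OF 1(3)]
      by (simp add: algebra_simps power_mult_distrib)
  qed
  also have "\<dots> = ?Z g + ?Z (\<lambda>m. g (?v3 + m))"
    by (simp add: sum.distrib)
  also have "\<dots> = (\<Sum>S\<in>Pow I. g (sum v S + sum v S + sum v S)) + (\<Sum>S\<in>Pow I. g (?v3 + (sum v S + sum v S + sum v S)))"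
    using insert.IH[of g] insert.IH[of "\<lambda>m. g (?v3 + m)"] insert.prems by simp
  also have "\<dots> = (\<Sum>S\<in>Pow (insert i I). g (sum v S + sum v S + sum v S))"
    unfolding sum_Pow_insert[OF insert.hyps]
    by (subst sum.distrib [symmetric], intro sum.cong refl) (simp add: ins add_ac)
  finally show ?case .
qed

locale cube_root =
  fixes \<omega> :: complex
  assumes \<omega>: "1 + \<omega> + \<omega>\<^sup>2 = 0"
begin

lemma \<omega>3: "\<omega> ^ 3 = 1"
proof -
  have "\<omega> ^ 3 - 1 = (\<omega> - 1) * (1 + \<omega> + \<omega>\<^sup>2)" by algebra
  then show ?thesis using \<omega> by simp
qed

definition chi :: "int \<Rightarrow> complex" where "chi m = \<omega> powi m"

lemma \<omega>_nz: "\<omega> \<noteq> 0" using \<omega> by auto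

lemma chi_add: "chi (m + n) = chi m * chi n"
  unfolding chi_def using \<omega>_nz by (simp add: power_int_add)

lemma chi_3: "chi (3 * m) = 1"
  unfolding chi_def by (simp add: power_int_mult \<omega>3)

text \<open>Borwein's b(q) as a character sum over the lattice.\<close>

definition twisted_theta :: "complex fps" where "twisted_theta = gf UNIV nrm (\<lambda>(x, y). chi (x - y))"

lemma chi_charge: "finite T \<Longrightarrow> chi (charge T) = (\<Prod>i\<in>T. chi (sg i))"
  by (induction T rule: finite_induct) (simp_all add: charge_def chi_add, simp add: chi_def)

lemma chi_sg: "1 + chi (sg i) + (chi (sg i))\<^sup>2 = 0"
proof -
  have "\<omega>\<^sup>2 * (1 + inverse \<omega> + (inverse \<omega>)\<^sup>2) = 1 + \<omega> + \<omega>\<^sup>2"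
    using \<omega>_nz by (simp add: field_simps power2_eq_square)
  then have "1 + inverse \<omega> + (inverse \<omega>)\<^sup>2 = 0" using \<omega> \<omega>_nz by simp
  then show ?thesis using \<omega> by (simp add: sg_def chi_def power_int_minus)
qed

text \<open>Weight the second state by \<open>chi\<close> of its charge and the third by the square
  of that. After cancellation only a sum over S = T = U remains, and such a triple has three times
  the energy of one neutral state.\<close>

lemma cub_Q: "cub Q = twisted_theta * Q ^ 3"
proof -
  let ?c = "\<lambda>(S, T, U). chi (charge T + 2 * charge U)"
  let ?e = "\<lambda>(S, T, U). energy S + energy T + energy U"
  have "gf triples ?e ?c = gf UNIV nrm (\<lambda>(x, y). chi (x - y)) * gf neutral (\<lambda>S. 1 * energy S) one_wt ^ 3"
  proof (rule gf_triples[OF _ finite_fibres_nrm])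
    fix x y S T U assume n: "S \<in> neutral" "T \<in> neutral" "U \<in> neutral"
    show "?e (transl x S, transl y T, transl (- x - y) U) = nrm (x, y) + 1 * (energy S + energy T + energy U)"
      using energy_triple[OF n] by simp
    \<comment> \<open>The exponent -2 x - y agrees with x - y modulo 3.\<close>
    have "chi (y + 2 * (- x - y)) = chi (x - y) * chi (3 * (- x))"
      unfolding chi_add[symmetric] by (rule arg_cong[of _ _ chi]) simp
    then show "?c (transl x S, transl y T, transl (- x - y) U) = (case (x, y) of (x, y) \<Rightarrow> chi (x - y))"
      using n unfolding chi_3 by (simp add: energy_transl(2))
  qed simp
  moreover have "gf triples ?e ?c = gf neutral (\<lambda>S. 3 * energy S) one_wt"
  proof (rule fps_ext)
    fix n
    let ?I = "{- int n..int n}"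
    \<comment> \<open>\<open>?v\<close> records charge and energy together, and \<open>?g\<close>
      selects total charge 0 and energy \<open>n\<close>. States of energy at most \<open>n\<close>
      are subsets of \<open>?I\<close>, so all sums become finite.\<close>
    let ?v = "\<lambda>i. (sg i, nat \<bar>i\<bar>)"
    let ?g = "\<lambda>m. if m = (0, n) then 1 else 0 :: complex"
    let ?w = "\<lambda>i. chi (sg i)"
    have v: "sum ?v S = (charge S, energy S)" if "finite S" for S
      by (simp add: prod_eq_iff fst_sum snd_sum charge_def energy_def)
    have fin: "finite S" if "S \<in> Pow ?I" for S using that finite_subset by auto
    have sub: "S \<in> Pow ?I" if "finite S" "energy S \<le> n" for S
    proof (intro PowI subsetI)
      fix i assume "i \<in> S"
      then have "nat \<bar>i\<bar> \<le> n"
        using that member_le_sum[of i S "\<lambda>i. nat \<bar>i\<bar>"] by (simp add: energy_def)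
      then show "i \<in> {- int n..int n}" by auto
    qed
    have P: "finite (Pow ?I \<times> Pow ?I \<times> Pow ?I)" by simp
    have "gf triples ?e ?c $ n = (\<Sum>p\<in>{p\<in>Pow ?I \<times> Pow ?I \<times> Pow ?I. 
         case p of (S, T, U) \<Rightarrow> sum ?v S + sum ?v T + sum ?v U = (0, n)}. ?c p)"
      unfolding gf_nth
    proof (rule sum.cong[OF _ refl], intro set_eqI iffI, goal_cases)
      case (1 p)
      then obtain S T U where p: "p = (S, T, U)" "finite S" "finite T" "finite U"
        and c: "charge S + charge T + charge U = 0" "energy S + energy T + energy U = n"
        by (auto simp: triples_def)
      then have "S \<in> Pow ?I" "T \<in> Pow ?I" "U \<in> Pow ?I" by (intro sub; simp)+
      then show ?case using p c by (simp add: v)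
    next
      case (2 p)
      then show ?case using fin by (auto simp: triples_def v)
    qed
    also have "\<dots> = (\<Sum>(S, T, U)\<in>Pow ?I \<times> Pow ?I \<times> Pow ?I. 
        chi (charge T + 2 * charge U) * ?g (sum ?v S + sum ?v T + sum ?v U))"
      by (rule sum.mono_neutral_cong_left[OF P]) (auto split: if_splits)
    also have "\<dots> = (\<Sum>S\<in>Pow ?I. \<Sum>T\<in>Pow ?I. \<Sum>U\<in>Pow ?I. 
        chi (charge T + 2 * charge U) * ?g (sum ?v S + sum ?v T + sum ?v U))"
      by (simp only: sum.cartesian_product)
    also have "\<dots> = (\<Sum>S\<in>Pow ?I. \<Sum>T\<in>Pow ?I. \<Sum>U\<in>Pow ?I. prod ?w T * (prod ?w U)\<^sup>2
        * ?g (sum ?v S + sum ?v T + sum ?v U))"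
    proof (intro sum.cong refl, goal_cases)
      case (1 S T U)
      then have "finite T" "finite U" using fin by blast+
      then have "chi (charge T + 2 * charge U) = prod ?w T * (prod ?w U)\<^sup>2"
        unfolding chi_add mult_2 by (simp only: chi_charge power2_eq_square)
      then show ?case by (simp only:)
    qed
    also have "\<dots> = (\<Sum>S\<in>Pow ?I. ?g (sum ?v S + sum ?v S + sum ?v S))"
      by (rule cube_root_cancellation) (simp_all add: chi_sg)
    also have "\<dots> = (\<Sum>S\<in>{S\<in>Pow ?I. sum ?v S + sum ?v S + sum ?v S = (0, n)}. 1)"
      by (rule sum.mono_neutral_cong_right) (auto split: if_splits)
    also have "\<dots> = gf neutral (\<lambda>S. 3 * energy S) one_wt $ n"
      unfolding gf_nth
    proof (rule sum.cong[OF _ refl], intro set_eqI iffI, goal_cases)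
      case (1 S)
      then show ?case using fin by (auto simp: neutral_def v)
    next
      case (2 S)
      then have "S \<in> Pow ?I" by (intro sub) (auto simp: neutral_def)
      with 2 show ?case by (auto simp: neutral_def v)
    qed
    finally show "gf triples ?e ?c $ n = gf neutral (\<lambda>S. 3 * energy S) one_wt $ n" .
  qed
  ultimately show ?thesis by (simp add: twisted_theta_def Q_def gf_scale)
qed

end

section \<open>Three-dissection of the theta series\<close>

text \<open>Class 0 is a sublattice of index 3, parametrised by a similarity that triples the norm.
  Class 1 splits modulo 3 into (1, 0), (2, 1), (0, 2), permuted by the norm-preserving rotation (x,
  y) -> (-x - y, x). Swapping coordinates exchanges classes 1 and 2.\<close>

lemma gf_class:
  "gf {(x, y). (x - y) mod 3 = 0} nrm one_wt = cub theta_a"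
  "gf {(x, y). (x - y) mod 3 = 1} nrm one_wt = 3 * fps_X * cub theta_c"
  "gf {(x, y). (x - y) mod 3 = 2} nrm one_wt = 3 * fps_X * cub theta_c"
proof -
  let ?C = "\<lambda>r. {(x, y). (x - y) mod 3 = r} :: (int \<times> int) set"
  have "gf (?C 0) nrm one_wt = gf UNIV (\<lambda>p. 3 * nrm p) one_wt"
  proof (rule gf_reindex)
    show "bij_betw (\<lambda>(s, t). (s + 2 * t, s - t)) UNIV (?C 0)"
    proof (rule bij_betw_byWitness[where f' = "\<lambda>(x, y). (y + (x - y) div 3, (x - y) div 3)"])
      show "\<forall>p\<in>?C 0. (case case p of (x, y) \<Rightarrow> (y + (x - y) div 3, (x - y) div 3) of
         (s, t) \<Rightarrow> (s + 2 * t, s - t)) = p"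
        by auto
    qed auto
    fix p :: "int \<times> int"
    obtain s t where p: "p = (s, t)" by (cases p)
    have "int (nrm (s + 2 * t, s - t)) = int (3 * nrm (s, t))"
      unfolding of_nat_mult int_nrm by simp algebra
    then show "nrm (case p of (s, t) \<Rightarrow> (s + 2 * t, s - t)) = 3 * nrm p"
      unfolding p by simp
  qed auto
  then show "gf (?C 0) nrm one_wt = cub theta_a" by (simp add: gf_scale theta_a_def)
  let ?D = "\<lambda>r s. {(x, y). x mod 3 = r \<and> y mod 3 = s} :: (int \<times> int) set"
  note ff = finite_fibres_subset[OF finite_fibres_nrm subset_UNIV]
  let ?G = "gf UNIV (\<lambda>p. Suc (3 * nrm3 p)) one_wt"
  have g10: "gf (?D 1 0) nrm one_wt = ?G"
  proof (rule gf_reindex)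
    show "bij_betw (\<lambda>(x, y). (3 * x + 1, 3 * y)) UNIV (?D 1 0)"
      by (rule bij_betw_byWitness[where f' = "\<lambda>(x, y). (x div 3, y div 3)"]) (auto, (presburger+)?)
  qed (auto simp: nrm_nrm3)
  have rot: "nrm (- x - y, x) = nrm (x, y)" for x y
  proof -
    have "int (nrm (- x - y, x)) = int (nrm (x, y))"
      unfolding int_nrm by algebra
    then show ?thesis by simp
  qed
  have g21: "gf (?D 2 1) nrm one_wt = gf (?D 1 0) nrm one_wt"
  proof (rule gf_reindex)
    show "bij_betw (\<lambda>(x, y). (- x - y, x)) (?D 1 0) (?D 2 1)"
      by (rule bij_betw_byWitness[where f' = "\<lambda>(x, y). (y, - x - y)"]) (auto, (presburger+)?)
  qed (auto simp: rot)
  have g02: "gf (?D 0 2) nrm one_wt = gf (?D 2 1) nrm one_wt"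
  proof (rule gf_reindex)
    show "bij_betw (\<lambda>(x, y). (- x - y, x)) (?D 2 1) (?D 0 2)"
      by (rule bij_betw_byWitness[where f' = "\<lambda>(x, y). (y, - x - y)"]) (auto, (presburger+)?)
  qed (auto simp: rot)
  have C1: "?C 1 = ?D 1 0 \<union> (?D 2 1 \<union> ?D 0 2)" by (auto, (presburger+)?)
  have "gf (?C 1) nrm one_wt = gf (?D 1 0) nrm one_wt + gf (?D 2 1 \<union> ?D 0 2) nrm one_wt"
    unfolding C1 by (rule gf_Un[OF ff ff]) auto
  also have "gf (?D 2 1 \<union> ?D 0 2) nrm one_wt = gf (?D 2 1) nrm one_wt + gf (?D 0 2) nrm one_wt"
    by (rule gf_Un[OF ff ff]) auto
  also have "gf (?D 1 0) nrm one_wt + (gf (?D 2 1) nrm one_wt + gf (?D 0 2) nrm one_wt) = 3 * ?G" unfolding g02 g21 g10 by simp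
  finally show c1: "gf (?C 1) nrm one_wt = 3 * fps_X * cub theta_c"
    by (simp add: gf_Suc gf_scale theta_c_def)
  have "gf (?C 2) nrm one_wt = gf (?C 1) nrm one_wt"
  proof (rule gf_reindex)
    show "bij_betw (\<lambda>(x, y). (y, x)) (?C 1) (?C 2)"
      by (rule bij_betw_byWitness[where f' = "\<lambda>(x, y). (y, x)"]) (auto, (presburger+)?)
  next
    fix p :: "int \<times> int"
    obtain x y where p: "p = (x, y)" by (cases p)
    have "int (nrm (y, x)) = int (nrm (x, y))" unfolding int_nrm by algebra
    then show "nrm (case p of (x, y) \<Rightarrow> (y, x)) = nrm p" unfolding p by simp
  qed auto
  with c1 show "gf (?C 2) nrm one_wt = 3 * fps_X * cub theta_c" by simp
qed

text \<open>One dissection serves both series: constant \<open>d\<close> gives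
  \<open>theta_a\<close>, and \<open>chi\<close> gives the twisted series.\<close>

lemma gf_dissection:
  assumes "\<And>m n. m mod 3 = n mod 3 \<Longrightarrow> d m = d n"
  shows "gf UNIV nrm (\<lambda>(x, y). d (x - y)) = fps_const (d 0) * cub theta_a + 
    fps_const (d 1 + d 2) * (3 * fps_X * cub theta_c)"
proof -
  let ?C = "\<lambda>r. {(x, y). (x - y) mod 3 = r} :: (int \<times> int) set"
  let ?d = "\<lambda>(x, y). d (x - y)"
  note ff = finite_fibres_subset[OF finite_fibres_nrm subset_UNIV]
  have g: "gf (?C r) nrm ?d = fps_const (d r) * gf (?C r) nrm one_wt" if "r mod 3 = r" for r
  proof -
    have "gf (?C r) nrm ?d = gf (?C r) nrm (\<lambda>p. d r * 1)"
    proof (rule gf_cong)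
      fix p assume "p \<in> ?C r"
      then show "?d p = d r * 1" using assms[of "fst p - snd p" r] that by auto
    qed simp
    then show ?thesis by (simp only: gf_cmult)
  qed
  have U: "UNIV = ?C 0 \<union> (?C 1 \<union> ?C 2)" by (auto, (presburger+)?)
  have "gf UNIV nrm ?d = gf (?C 0) nrm ?d + gf (?C 1 \<union> ?C 2) nrm ?d"
    unfolding U by (rule gf_Un[OF ff ff]) auto
  also have "gf (?C 1 \<union> ?C 2) nrm ?d = gf (?C 1) nrm ?d + gf (?C 2) nrm ?d"
    by (rule gf_Un[OF ff ff]) auto
  also have "gf (?C 0) nrm ?d = fps_const (d 0) * gf (?C 0) nrm one_wt" by (rule g) simp
  also have "gf (?C 1) nrm ?d = fps_const (d 1) * gf (?C 1) nrm one_wt" by (rule g) simp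
  also have "gf (?C 2) nrm ?d = fps_const (d 2) * gf (?C 2) nrm one_wt" by (rule g) simp
  finally show ?thesis unfolding gf_class 
    by (simp add: algebra_simps flip: fps_const_add)
qed

lemma theta_a_dissection: "theta_a = cub theta_a + 6 * (fps_X * cub theta_c)"
proof -
  have e: "(\<lambda>(x :: int, y :: int). 1 :: complex) = (\<lambda>_. 1)" by (intro ext) (simp split: prod.splits)
  have "theta_a = cub theta_a + fps_const 2 * (3 * fps_X * cub theta_c)"
    using gf_dissection[of one_wt, OF refl] unfolding e theta_a_def[symmetric] by simp
  then show ?thesis by (simp add: numeral_fps_const[symmetric] mult.assoc)
qed

lemma (in cube_root) twisted_dissection: "twisted_theta = cub theta_a - 3 * (fps_X * cub theta_c)"
proof -
  have "chi 2 = \<omega>\<^sup>2" "chi 1 = \<omega>" "chi 0 = 1" by (simp_all add: chi_def)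
  moreover have "\<omega> + \<omega>\<^sup>2 = (1 + \<omega> + \<omega>\<^sup>2) - 1" by simp
  ultimately have "chi 1 + chi 2 = - 1" "chi 0 = 1" unfolding \<omega> by simp_all
  moreover have "chi m = chi n" if "m mod 3 = n mod 3" for m n
  proof -
    from that have "m = n + 3 * (m div 3 - n div 3)" by presburger
    then show ?thesis by (metis chi_add chi_3 mult.right_neutral)
  qed
  then have "gf UNIV nrm (\<lambda>(x, y). chi (x - y)) = fps_const (chi 0) * cub theta_a + 
    fps_const (chi 1 + chi 2) * (3 * fps_X * cub theta_c)" by (rule gf_dissection)
  ultimately show ?thesis unfolding twisted_theta_def by (simp add: mult.assoc flip: fps_const_neg)
qed

text \<open>The twisted series, written through its dissection so that no root of unity
  appears.\<close>

definition theta_b :: "complex fps" where "theta_b = cub theta_a - 3 * (fps_X * cub theta_c)"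

lemma theta_b_Q: "theta_b * Q ^ 3 = cub Q"
proof -
  have "1 + Complex (-1/2) (sqrt 3 / 2) + (Complex (-1/2) (sqrt 3 / 2))\<^sup>2 = 0"
    by (simp add: complex_eq_iff power2_eq_square)
  then interpret cube_root "Complex (-1/2) (sqrt 3 / 2)" by unfold_locales
  show ?thesis using cub_Q twisted_dissection by (simp add: theta_b_def)
qed

section \<open>The cubic identity\<close>

lemma cub_mult: "cub (f * g) = cub f * cub g"
  by (rule fps_compose_mult_distrib) simp

lemma cub_power: "cub (f ^ n) = cub f ^ n"
  by (induction n) (simp_all add: cub_mult)

lemma cub_X: "cub fps_X = fps_X ^ 3"
  by simp

lemmas cub_simps = cub_mult cub_power cub_X fps_compose_add_distrib fps_compose_sub_distrib numeral_compose

lemma Q_0: "Q $ 0 = 1"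
proof -
  have "S \<in> {S \<in> neutral. energy S = 0} \<longleftrightarrow> S \<in> {{}}" for S
  proof
    assume S: "S \<in> {S \<in> neutral. energy S = 0}"
    then have "\<forall>i\<in>S. nat \<bar>i\<bar> = 0"
      unfolding energy_def neutral_def by (auto simp del: nat_0_iff)
    then have "S \<subseteq> {0}" by auto
    \<comment> \<open>The set {0} also has energy 0, but its charge is -1.\<close>
    moreover have "charge S = 0" using S by (simp add: neutral_def)
    ultimately show "S \<in> {{}}" by (auto simp: subset_singleton_iff charge_def sg_def)
  qed (auto simp: neutral_def charge_def energy_def)
  then have "{S \<in> neutral. energy S = 0} = {{}}" by (rule set_eqI)
  then show ?thesis by (simp add: Q_def gf_nth)
qed

definition E :: "complex fps" where "E = inverse Q"

lemma Q_E: "Q * E = 1"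
  unfolding E_def by (rule inverse_mult_eq_1') (simp add: Q_0)

lemma cub_Q_E: "cub Q * cub E = 1"
  by (metis Q_E cub_mult fps_compose_1)

text \<open>The reciprocal of \<open>theta_b\<close>; see \<open>theta_b_beta\<close>.\<close>

definition beta :: "complex fps" where "beta = Q ^ 3 * cub E"

lemma theta_c_eq: "theta_c = Q * cub E ^ 3"
proof -
  have "Q * cub E ^ 3 = theta_c * (cub Q * cub E) ^ 3"
    by (subst Q_theta_c) (simp add: power_mult_distrib)
  then show ?thesis by (simp add: cub_Q_E)
qed

lemma theta_b_beta: "theta_b * beta = 1"
  unfolding beta_def using theta_b_Q cub_Q_E by (simp add: mult.assoc[symmetric])

lemma theta_b_eq: "theta_b = cub Q * E ^ 3"
proof -
  have "cub Q * E ^ 3 = theta_b * (Q * E) ^ 3"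
    by (subst theta_b_Q[symmetric]) (simp add: power_mult_distrib)
  then show ?thesis by (simp add: Q_E)
qed

text \<open>Both sides are \<open>cub Q * cub E ^ 9\<close> once products of reciprocals are
  cancelled. The relation makes the defect in \<open>cubic_identity\<close> reappear at q^3.\<close>

lemma theta_c_b: "theta_b * theta_c ^ 3 = cub theta_c * cub theta_b ^ 3"
proof -
  have "theta_b * theta_c ^ 3 = cub Q * cub E ^ 9 * (Q * E) ^ 3"
    unfolding theta_b_eq theta_c_eq by algebra
  moreover have "cub theta_c * cub theta_b ^ 3 = cub Q * cub E ^ 9 * (cub (cub Q) * cub (cub E)) ^ 3"
    unfolding theta_b_eq theta_c_eq cub_simps by algebra
  moreover have "cub (cub Q) * cub (cub E) = 1"
    by (metis cub_Q_E cub_mult fps_compose_1)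
  ultimately show ?thesis by (simp add: Q_E)
qed

text \<open>
  The defect \<open>H\<close> of the cubic identity satisfies \<open>theta_b * H = 27 * q * theta_c(q\<^sup>3) * H(q\<^sup>3)\<close>. A nonzero \<open>H\<close>
  of order \<open>d\<close> would give \<open>d = 1 + 3 * d\<close>.
\<close>

lemma cubic_identity: "theta_a ^ 3 = theta_b ^ 3 + 27 * (fps_X * theta_c ^ 3)"
proof -
  define H where "H = theta_a ^ 3 - theta_b ^ 3 - 27 * (fps_X * theta_c ^ 3)"
  define k where "k = fps_X * cub theta_c"
  have a: "theta_a = cub theta_a + 6 * k" and b: "theta_b = cub theta_a - 3 * k"
    using theta_a_dissection by (simp_all add: k_def theta_b_def)
  have "theta_b * H = 27 * k * (cub theta_a ^ 3 - 27 * k ^ 3) - 27 * (fps_X * (theta_b * theta_c ^ 3))"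
  proof -
    \<comment> \<open>With a = A + 6 k and b = A - 3 k, the difference of cubes has the factor a - b
      = 9 k; multiplication by b turns the remaining quadratic into a difference of cubes.\<close>
    have "(A - 3 * k) * ((A + 6 * k) ^ 3 - (A - 3 * k) ^ 3) = 27 * k * (A ^ 3 - 27 * k ^ 3)" for A
      by algebra
    then have "theta_b * (theta_a ^ 3 - theta_b ^ 3) = 27 * k * (cub theta_a ^ 3 - 27 * k ^ 3)"
      unfolding b by (subst (2) a) blast
    then show ?thesis unfolding H_def by (simp add: right_diff_distrib mult.left_commute)
  qed
  also have "\<dots> = 27 * k * cub H"
    unfolding theta_c_b H_def cub_simps k_def by algebra
  finally have eq: "theta_b * H = 27 * k * cub H" .
  have "H = 0"
  proof (rule ccontr)
    assume H: "H \<noteq> 0"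
    have nz: "theta_b \<noteq> 0" using theta_b_beta by auto
    let ?d = "subdegree H"
    \<comment> \<open>\<open>cub H\<close> has no term below degree \<open>?d\<close> and
      \<open>k\<close> supplies a further factor q, so the right side vanishes through degree
      \<open>?d\<close>. The left side has a nonzero coefficient at the sum of the
      subdegrees.\<close>
    have "(27 * k * cub H) $ n = 0" if "n \<le> ?d + subdegree theta_b" for n
    proof -
      have b0: "subdegree theta_b = 0"
        using theta_b_beta by (metis fps_mult_nth_0 mult_zero_left one_neq_zero fps_one_nth subdegree_eq_0)
      have "(cub theta_c * cub H) $ m = 0" if "m < ?d" for m
      proof -
        have "cub H $ i = 0" if "i \<le> m" for i
          using that \<open>m < ?d\<close> by (auto simp: cub_nth intro!: nth_less_subdegree_zero)
        then show ?thesis by (simp add: fps_mult_nth)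
      qed
      then have "(fps_X * (cub theta_c * cub H)) $ n = 0"
        using that b0 by (cases n) (auto simp: fps_X_mult_nth)
      then show ?thesis by (simp add: k_def mult.assoc numeral_fps_const)
    qed
    then have "(theta_b * H) $ (subdegree theta_b + ?d) = 0" using eq by simp
    then show False using H nz by simp
  qed
  then show ?thesis unfolding H_def by algebra
qed

section \<open>Series as forms in \<open>A\<close> and \<open>L\<close> times series in q^3\<close>

abbreviation A :: "complex fps" where "A \<equiv> cub theta_a"

definition L :: "complex fps" where "L = 3 * (fps_X * cub theta_c)"

text \<open>The cofactor of A - L in A^3 - L^3.\<close>

definition D :: "complex fps" where "D = A\<^sup>2 + A * L + L\<^sup>2"

definition hm :: "complex fps" where "hm = 27 * (fps_X * (theta_c * beta) ^ 3)"

lemma a_AL: "theta_a = A + 2 * L" and b_AL: "theta_b = A - L"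
  using theta_a_dissection by (simp_all add: L_def theta_b_def)

lemma c_hm: "27 * (fps_X * theta_c ^ 3) = theta_b ^ 3 * hm"
proof -
  have "theta_b ^ 3 * hm = 27 * (fps_X * theta_c ^ 3) * (theta_b * beta) ^ 3"
    unfolding hm_def by algebra
  then show ?thesis by (simp add: theta_b_beta)
qed

lemma a_hm: "theta_a ^ 3 = theta_b ^ 3 * (1 + hm)"
  using cubic_identity c_hm by (simp add: distrib_left)

text \<open>The cubic identity at q^3 reads A^3 - L^3 = b(q^3)^3; division by b = A - L to get 1 / b
  brings in \<open>D\<close>.\<close>

lemma beta_D: "beta = D * cub beta ^ 3"
proof -
  have "A ^ 3 - L ^ 3 = cub theta_b ^ 3"
    using arg_cong[OF cubic_identity, of cub] unfolding L_def cub_simps by algebra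
  moreover have "theta_b * D = A ^ 3 - L ^ 3"
    unfolding b_AL D_def by algebra
  moreover have "cub theta_b * cub beta = 1"
    by (metis theta_b_beta cub_mult fps_compose_1)
  moreover have "D * cub beta ^ 3 = beta * (theta_b * D) * cub beta ^ 3"
    using theta_b_beta by (simp add: mult.assoc[symmetric] mult.commute[of beta])
  ultimately show ?thesis
    by (simp add: power_mult_distrib[symmetric] mult.assoc)
qed

lemma hm_D: "hm = 9 * L * D ^ 4 * cub beta ^ 9"
proof -
  \<comment> \<open>The factor \<open>cub (beta * theta_b) ^ 3\<close> is 1; it supplies the
    \<open>cub theta_b ^ 3\<close> needed for \<open>theta_c_b\<close>.\<close>
  have "9 * L * D ^ 4 * cub beta ^ 9 * cub (beta * theta_b) ^ 3 = 27 * fps_X * (cub theta_c * cub theta_b ^ 3) * (D * cub beta ^ 3) ^ 4"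
    unfolding L_def cub_simps by algebra
  also have "\<dots> = 27 * (fps_X * (theta_c * beta) ^ 3) * (theta_b * beta)"
    unfolding beta_D[symmetric] theta_c_b[symmetric] by algebra
  finally show ?thesis
    using theta_b_beta by (simp add: hm_def mult.commute[of beta])
qed

text \<open>Up to a power of 3 and an integer polynomial in \<open>hm\<close>, \<open>Fo\<close> and
  \<open>Fe\<close> are the generating functions along the main progressions whose modulus is an
  odd, respectively even, power of 3.\<close>

definition Fo :: "complex fps" where "Fo = theta_a * Q ^ 12 * cub E ^ 9"

definition Fe :: "complex fps" where "Fe = theta_a * Q ^ 15 * cub E ^ 12"

text \<open>Q^12 is \<open>beta ^ 4 * cub Q ^ 4\<close>, and \<open>beta_D\<close> turns
  \<open>beta ^ 4\<close> into \<open>D ^ 4\<close> times a series in q^3. All but a form in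
  \<open>A\<close> and \<open>L\<close> then depends on q^3 only, ready for trisection.\<close>

lemma Fo_D: "Fo = (A + 2 * L) * D ^ 4 * cub (E ^ 5 * beta ^ 12)"
proof -
  have "(A + 2 * L) * D ^ 4 * cub (E ^ 5 * beta ^ 12) = theta_a * (D * cub beta ^ 3) ^ 4 * cub E ^ 5"
    unfolding a_AL[symmetric] cub_simps by algebra
  also have "\<dots> = Fo" unfolding beta_D[symmetric] Fo_def unfolding beta_def by algebra
  finally show ?thesis by simp
qed

lemma Fe_D: "Fe = (A + 2 * L) * D ^ 5 * cub (E ^ 7 * beta ^ 15)"
proof -
  have "(A + 2 * L) * D ^ 5 * cub (E ^ 7 * beta ^ 15) = theta_a * (D * cub beta ^ 3) ^ 5 * cub E ^ 7"
    unfolding a_AL[symmetric] cub_simps by algebra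
  also have "\<dots> = Fe" unfolding beta_D[symmetric] Fe_def unfolding beta_def by algebra
  finally show ?thesis by simp
qed

lemma start_D: "theta_a * Q ^ 3 = (A + 2 * L) * D * cub (Q * beta ^ 3)"
proof -
  have "(A + 2 * L) * D * cub (Q * beta ^ 3) = theta_a * (D * cub beta ^ 3) * cub Q"
    unfolding a_AL[symmetric] cub_simps by algebra
  also have "\<dots> = theta_a * Q ^ 3 * (cub Q * cub E)"
    unfolding beta_D[symmetric] unfolding beta_def by algebra
  finally show ?thesis by (simp add: cub_Q_E)
qed

lemma Fo_hm: "Fo * hm ^ i = 9 ^ i * ((A + 2 * L) * D ^ 4 * (L * D ^ 4) ^ i * cub (E ^ 5 * beta ^ (12 + 9 * i)))"
proof -
  have "hm ^ i = 9 ^ i * (L * D ^ 4) ^ i * cub beta ^ (9 * i)"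
    unfolding hm_D by (simp add: power_mult_distrib power_mult)
  then show ?thesis
    unfolding Fo_D cub_simps power_add by (simp add: mult_ac)
qed

lemma Fe_hm: "Fe * hm ^ i = 9 ^ i * ((A + 2 * L) * D ^ 5 * (L * D ^ 4) ^ i * cub (E ^ 7 * beta ^ (15 + 9 * i)))"
proof -
  have "hm ^ i = 9 ^ i * (L * D ^ 4) ^ i * cub beta ^ (9 * i)"
    unfolding hm_D by (simp add: power_mult_distrib power_mult)
  then show ?thesis
    unfolding Fe_D cub_simps power_add by (simp add: mult_ac)
qed

section \<open>Trisection of power series\<close>

definition sect :: "nat \<Rightarrow> complex fps \<Rightarrow> complex fps" where
  "sect r f = Abs_fps (\<lambda>n. f $ (3 * n + r))"

section \<open>Integer-linear maps and integer spans\<close>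

definition zlinear :: "(complex fps \<Rightarrow> complex fps) \<Rightarrow> bool" where
  "zlinear h \<longleftrightarrow> (\<forall>f g c. h (f + of_int c * g) = h f + of_int c * h g)"

definition zclosed :: "complex fps set \<Rightarrow> bool" where
  "zclosed S \<longleftrightarrow> 0 \<in> S \<and> (\<forall>f\<in>S. \<forall>g\<in>S. \<forall>c. f + of_int c * g \<in> S)"

inductive_set zspan :: "complex fps set \<Rightarrow> complex fps set" for G where
  zspan_0: "0 \<in> zspan G"
| zspan_step: "f \<in> zspan G \<Longrightarrow> g \<in> G \<Longrightarrow> f + of_int c * g \<in> zspan G"

lemma zclosed_zspan: "zclosed (zspan G)"
proof -
  have "f + of_int c * g \<in> zspan G" if "g \<in> zspan G" "f \<in> zspan G" for f g c
    using that
  proof (induction g)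
    case zspan_0
    then show ?case by simp
  next
    case (zspan_step g x d)
    then have "(f + of_int c * g) + of_int (c * d) * x \<in> zspan G"
      by (intro zspan.zspan_step[of "f + of_int c * g"]) auto
    then show ?case by (simp add: algebra_simps)
  qed
  then show ?thesis by (auto simp: zclosed_def zspan.zspan_0)
qed

lemma zclosed_add: "zclosed S \<Longrightarrow> f \<in> S \<Longrightarrow> g \<in> S \<Longrightarrow> f + g \<in> S"
  and zclosed_of_int: "zclosed S \<Longrightarrow> f \<in> S \<Longrightarrow> of_int c * f \<in> S"
proof -
  assume S: "zclosed S"
  show "f + g \<in> S" if "f \<in> S" "g \<in> S"
  proof -
    have "f + of_int 1 * g \<in> S" using S that unfolding zclosed_def by blast
    then show ?thesis by simp
  qed
  show "of_int c * f \<in> S" if "f \<in> S"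
  proof -
    have "0 + of_int c * f \<in> S" using S that unfolding zclosed_def by blast
    then show ?thesis by simp
  qed
qed

lemma zspan_base: "g \<in> G \<Longrightarrow> g \<in> zspan G"
  using zspan_step[OF zspan_0, of g G 1] by simp

lemma zclosed_scale: "zclosed S \<Longrightarrow> zclosed ((*) k ` S)"
proof -
  assume S: "zclosed S"
  have "k * f + of_int c * (k * g) \<in> (*) k ` S" if "f \<in> S" "g \<in> S" for f g c
  proof
    show "k * f + of_int c * (k * g) = k * (f + of_int c * g)" by (simp add: algebra_simps)
    show "f + of_int c * g \<in> S" using S that by (auto simp: zclosed_def)
  qed
  moreover have "0 \<in> (*) k ` S" using S by (force simp: zclosed_def)
  ultimately show ?thesis unfolding zclosed_def by blast
qed

text \<open>Reduces a claim about all integer combinations to the generators; used below with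
  multiplication and trisection as \<open>h\<close>.\<close>

lemma zspan_into:
  assumes "f \<in> zspan G" "zclosed S" "zlinear h" "\<And>g. g \<in> G \<Longrightarrow> h g \<in> S"
  shows "h f \<in> S"
  using assms(1)
proof induction
  case zspan_0
  have "h (0 + of_int (- 1) * 0) = h 0 + of_int (- 1) * h 0"
    using assms(3) unfolding zlinear_def by blast
  then show ?case using assms(2) by (simp add: zclosed_def)
next
  case (zspan_step f g c)
  then show ?case using assms(2-4) unfolding zlinear_def zclosed_def by metis
qed

lemma zlinear_mult: "zlinear (\<lambda>f. f * g)"
  by (simp add: zlinear_def algebra_simps)

lemma zspan_mult:
  assumes "f \<in> zspan G" "g \<in> zspan G'" "\<And>x y. x \<in> G \<Longrightarrow> y \<in> G' \<Longrightarrow> x * y \<in> zspan G''"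
  shows "f * g \<in> zspan G''"
proof (rule zspan_into[OF assms(1) zclosed_zspan zlinear_mult])
  fix x assume "x \<in> G"
  then have "y * x \<in> zspan G''" if "y \<in> G'" for y
    using assms(3)[of x y] that by (simp add: mult.commute)
  then have "g * x \<in> zspan G''"
    by (rule zspan_into[OF assms(2) zclosed_zspan zlinear_mult])
  then show "x * g \<in> zspan G''" by (simp add: mult.commute)
qed

lemma of_int_mult_nth: "(of_int c * f) $ n = of_int c * f $ n" for f :: "complex fps"
  by (simp add: fps_of_int[symmetric])

lemma zlinear_sect_mult: "zlinear (\<lambda>f. sect r (f * g))"
  unfolding zlinear_def sect_def by (auto simp: fps_eq_iff distrib_right mult.assoc of_int_mult_nth)

lemma zlinear_sect: "zlinear (sect r)"
  using zlinear_sect_mult[of r 1] by simp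

lemma sect_add: "sect r (f + g) = sect r f + sect r g"
  by (simp add: sect_def fps_eq_iff)

lemma sect_of_int: "sect r (of_int c * f) = of_int c * sect r f"
  by (simp add: sect_def fps_eq_iff of_int_mult_nth)

lemma sect_numeral: "sect r (numeral c * f) = numeral c * sect r f"
  using sect_of_int[of r "numeral c" f] by simp

lemma sect_numeral_power: "sect r (numeral c ^ i * f) = numeral c ^ i * sect r f"
  using sect_of_int[of r "numeral c ^ i" f] by simp

lemma sect_X_cub:
  assumes "r < 3"
  shows "sect r (fps_X ^ j * cub g) = (if j mod 3 = r then fps_X ^ (j div 3) * g else 0)"
proof (rule fps_ext)
  fix n
  have "sect r (fps_X ^ j * cub g) $ n = (if 3 * n + r < j \<or> \<not> 3 dvd (3 * n + r - j) then 0 else g $ ((3 * n + r - j) div 3))"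
    by (auto simp: sect_def fps_X_power_mult_nth cub_nth)
  also have "\<dots> = (if j mod 3 = r then fps_X ^ (j div 3) * g else 0) $ n"
  proof (cases "j mod 3 = r")
    case True
    then obtain l where "j = 3 * l + r" by (metis mult_div_mod_eq)
    then show ?thesis using assms by (auto simp: fps_X_power_mult_nth diff_mult_distrib2[symmetric])
  next
    case False
    then have "3 * n + r < j \<or> \<not> 3 dvd (3 * n + r - j)" using assms by presburger
    then show ?thesis using False by simp
  qed
  finally show "sect r (fps_X ^ j * cub g) $ n = (if j mod 3 = r then fps_X ^ (j div 3) * g else 0) $ n" .
qed

text \<open>\<open>L\<close> is 3 q times a series in q^3, so its degree alone decides the residue
  class, and each power brings a factor 3.\<close>

lemma sect_monomial:
  assumes "r < 3"
  shows "sect r (A ^ s * L ^ j * cub g) = 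
    (if j mod 3 = r then 3 ^ j * (fps_X ^ (j div 3) * (theta_a ^ s * theta_c ^ j * g)) else 0)"
proof -
  have "A ^ s * L ^ j * cub g = 3 ^ j * (fps_X ^ j * cub (theta_a ^ s * theta_c ^ j * g))"
    unfolding L_def cub_simps by (simp add: power_mult_distrib mult_ac)
  then show ?thesis using sect_X_cub[OF assms] by (simp add: sect_numeral_power)
qed

section \<open>Homogeneous forms\<close>

definition Forms :: "nat \<Rightarrow> complex fps set" where
  "Forms d = zspan {A ^ s * L ^ j |s j. s + j = d}"

lemma Forms_monomial: "s + j = d \<Longrightarrow> A ^ s * L ^ j \<in> Forms d"
  unfolding Forms_def by (rule zspan_base) auto

lemma Forms_mult: "f \<in> Forms d \<Longrightarrow> g \<in> Forms e \<Longrightarrow> d + e = n \<Longrightarrow> f * g \<in> Forms n"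
  unfolding Forms_def
proof (erule zspan_mult, assumption)
  fix x y assume "d + e = n" "x \<in> {A ^ s * L ^ j |s j. s + j = d}" "y \<in> {A ^ s * L ^ j |s j. s + j = e}"
  then obtain s j s' j' where xy: "x = A ^ s * L ^ j" "y = A ^ s' * L ^ j'" and n: "s + j + (s' + j') = n"
    by blast
  have "x * y = A ^ (s + s') * L ^ (j + j')" by (simp add: xy power_add mult_ac)
  moreover have "A ^ (s + s') * L ^ (j + j') \<in> {A ^ s * L ^ j |s j. s + j = n}" 
    using n by (intro CollectI exI[of _ "s + s'"] exI[of _ "j + j'"]) simp
  ultimately show "x * y \<in> zspan {A ^ s * L ^ j |s j. s + j = n}" by (simp add: zspan_base)
qed

lemma Forms_power: "f \<in> Forms d \<Longrightarrow> n = k * d \<Longrightarrow> f ^ k \<in> Forms n"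
proof (induction k arbitrary: n)
  case 0
  then show ?case using Forms_monomial[of 0 0 0] by simp
next
  case (Suc k)
  then show ?case by (simp add: Forms_mult[of f d "f ^ k" "k * d"])
qed

lemma Forms_closed: "zclosed (Forms d)"
  unfolding Forms_def by (rule zclosed_zspan)

lemma Forms_add: "f \<in> Forms d \<Longrightarrow> g \<in> Forms d \<Longrightarrow> f + g \<in> Forms d"
  by (rule zclosed_add[OF Forms_closed])

lemma Forms_numeral: "f \<in> Forms d \<Longrightarrow> numeral c * f \<in> Forms d"
  using zclosed_of_int[OF Forms_closed, of f d "numeral c"] by simp

lemma Forms_L: "L \<in> Forms 1" and Forms_A2L: "A + 2 * L \<in> Forms 1" and Forms_D: "D \<in> Forms 2"
proof -
  have A: "A \<in> Forms 1" using Forms_monomial[of 1 0 1] by simp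
  show L: "L \<in> Forms 1" using Forms_monomial[of 0 1 1] by simp
  show "A + 2 * L \<in> Forms 1" by (intro Forms_add Forms_numeral A L)
  show "D \<in> Forms 2"
    unfolding D_def by (intro Forms_add Forms_power[of _ 1] Forms_mult[OF A L] A L) auto
qed

definition Mod :: "complex fps \<Rightarrow> complex fps set" where
  "Mod F = zspan (range (\<lambda>i. F * hm ^ i))"

lemma Mod_closed: "zclosed (Mod F)"
  unfolding Mod_def by (rule zclosed_zspan)

text \<open>Expands (1 + hm)^k one factor at a time; such powers arise from theta_a^(3 k) by
  \<open>a_hm\<close>.\<close>

lemma Mod_shift: "F * ((1 + hm) ^ k * hm ^ l) \<in> Mod F"
proof (induction k arbitrary: l)
  case 0
  have "F * hm ^ l \<in> Mod F" unfolding Mod_def by (rule zspan_base) blast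
  then show ?case by simp
next
  case (Suc k)
  have "F * ((1 + hm) ^ k * hm ^ l) + F * ((1 + hm) ^ k * hm ^ Suc l) \<in> Mod F"
    by (rule zclosed_add[OF Mod_closed Suc Suc])
  then show ?case by (simp add: algebra_simps)
qed

text \<open>A surviving monomial has j = 3 l + r, and the degree forces s = 3 (m - l) + 1. Beyond
  theta_a theta_c^r only cubes remain, which \<open>a_hm\<close> and \<open>c_hm\<close> turn into
  theta_b^(3 m) times a polynomial in \<open>hm\<close>. Of 3^j the part 27^l is absorbed into
  \<open>hm\<close>, leaving 3^r.\<close>

lemma sect_Forms:
  assumes "f \<in> Forms (3 * m + r + 1)" "r < 3"
  shows "sect r (f * cub g) \<in> (*) (3 ^ r) ` Mod (theta_a * theta_c ^ r * theta_b ^ (3 * m) * g)"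
    (is "_ \<in> (*) _ ` Mod ?F")
proof (rule zspan_into[OF assms(1)[unfolded Forms_def] zclosed_scale[OF Mod_closed] zlinear_sect_mult])
  fix x assume "x \<in> {A ^ s * L ^ j |s j. s + j = 3 * m + r + 1}"
  then obtain s j where x: "x = A ^ s * L ^ j" and d: "s + j = 3 * m + r + 1" by blast
  show "sect r (x * cub g) \<in> (*) (3 ^ r) ` Mod ?F"
  proof (cases "j mod 3 = r")
    case True
    define l where "l = j div 3"
    have j: "j = 3 * l + r" using True unfolding l_def by presburger
    define k where "k = m - l"
    have "l \<le> m" using d j by linarith
    then have s: "s = 3 * k + 1" and m: "3 * m = 3 * k + 3 * l" using d j by (auto simp: k_def)
    have "sect r (x * cub g) = 3 ^ j * (fps_X ^ l * (theta_a ^ s * theta_c ^ j * g))"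
      using sect_monomial[OF assms(2)] True unfolding x l_def by simp
    also have "\<dots> = 3 ^ r * (theta_a * theta_c ^ r * g * (theta_a ^ 3) ^ k * (27 * (fps_X * theta_c ^ 3)) ^ l)"
    proof -
      have e: "(27 :: complex fps) = 3 ^ 3" by simp
      show ?thesis
        unfolding j s e power_mult_distrib power_add power_mult power_one_right by (simp only: mult_ac)
    qed
    also have "\<dots> = 3 ^ r * (?F * ((1 + hm) ^ k * hm ^ l))"
      unfolding a_hm c_hm m power_mult_distrib power_add power_mult by (simp only: mult_ac)
    finally show ?thesis using Mod_shift[of ?F k l] by blast
  next
    case False
    then have "sect r (x * cub g) = 0" using sect_monomial[OF assms(2)] unfolding x by simp
    then show ?thesis using zclosed_scale[OF Mod_closed, of "3 ^ r" ?F] by (simp add: zclosed_def)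
  qed
qed

lemma theta_b_cancel: "theta_b ^ m * (beta ^ m * f) = f"
  using theta_b_beta by (simp add: mult.assoc[symmetric] power_mult_distrib[symmetric])

lemma Q_E_cancel: "Q ^ m * (E ^ m * f) = f"
  using Q_E by (simp add: mult.assoc[symmetric] power_mult_distrib[symmetric])

text \<open>The prefactor that \<open>sect_Forms\<close> produces from residue 2 of the terms of
  \<open>Fo\<close>. Cancelling \<open>theta_b\<close> leaves \<open>beta ^ 6\<close> for every
  \<open>i\<close>, so all terms land in the same module.\<close>

lemma Fe_form: "theta_a * theta_c\<^sup>2 * theta_b ^ (9 * i + 6) * (E ^ 5 * beta ^ (12 + 9 * i)) = Fe"
proof -
  have "theta_a * theta_c\<^sup>2 * theta_b ^ (9 * i + 6) * (E ^ 5 * beta ^ (12 + 9 * i))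
    = theta_b ^ (9 * i + 6) * (beta ^ (9 * i + 6) * (theta_a * theta_c\<^sup>2 * E ^ 5 * beta ^ 6))"
    by (simp add: power_add mult_ac flip: power_add[of beta 6 6, simplified])
  also have "\<dots> = theta_a * theta_c\<^sup>2 * E ^ 5 * beta ^ 6" by (rule theta_b_cancel)
  also have "\<dots> = Q ^ 5 * (E ^ 5 * Fe)" unfolding theta_c_eq beta_def Fe_def by algebra
  finally show ?thesis by (simp add: Q_E_cancel)
qed

text \<open>The corresponding prefactor from residue 1 of the terms of \<open>Fe\<close>.\<close>

lemma Fo_form: "theta_a * theta_c * theta_b ^ (9 * i + 9) * (E ^ 7 * beta ^ (15 + 9 * i)) = Fo"
proof -
  have "theta_a * theta_c * theta_b ^ (9 * i + 9) * (E ^ 7 * beta ^ (15 + 9 * i))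
    = theta_b ^ (9 * i + 9) * (beta ^ (9 * i + 9) * (theta_a * theta_c * E ^ 7 * beta ^ 6))"
    by (simp add: power_add mult_ac flip: power_add[of beta 9 6, simplified])
  also have "\<dots> = theta_a * theta_c * E ^ 7 * beta ^ 6" by (rule theta_b_cancel)
  also have "\<dots> = Q ^ 7 * (E ^ 7 * Fo)" unfolding theta_c_eq beta_def Fo_def by algebra
  finally show ?thesis by (simp add: Q_E_cancel)
qed

text \<open>In (A + 2 L) D only 3 A L^2 has degree 2 modulo 3 in \<open>L\<close>; it yields 3 * 9 =
  27.\<close>

lemma sect_start: "sect 2 (theta_a * Q ^ 3) = 27 * Fo"
proof -
  let ?g = "Q * beta ^ 3"
  have "theta_a * Q ^ 3 = A ^ 3 * L ^ 0 * cub ?g + 3 * (A ^ 2 * L ^ 1 * cub ?g)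
      + 3 * (A ^ 1 * L ^ 2 * cub ?g) + 2 * (A ^ 0 * L ^ 3 * cub ?g)"
    unfolding start_D D_def by algebra
  then have "sect 2 (theta_a * Q ^ 3) = 27 * (theta_a * theta_c\<^sup>2 * ?g)"
    by (simp only: sect_add sect_numeral sect_monomial) simp
  also have "theta_a * theta_c\<^sup>2 * ?g = Fo"
    unfolding theta_c_eq beta_def Fo_def by algebra
  finally show ?thesis .
qed

lemma mem_scale_mult: "f \<in> (*) k ` S \<Longrightarrow> l * f \<in> (*) (l * k) ` S" for k l :: "complex fps"
  by (auto simp: mult.assoc)

text \<open>Residue 2 gains 9 in every term. The other 9 comes from 9^i when i >= 1, and from the
  coefficients of the form when i = 0.\<close>

lemma sect_Fo: "f \<in> Mod Fo \<Longrightarrow> sect 2 f \<in> (*) 81 ` Mod Fe"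
  unfolding Mod_def[of Fo]
proof (erule zspan_into[OF _ zclosed_scale[OF Mod_closed] zlinear_sect], clarify)
  fix i
  have form: "sect 2 (f * cub (E ^ 5 * beta ^ (12 + 9 * i))) \<in> (*) 9 ` Mod Fe" if "f \<in> Forms (9 * i + 9)" for f
  proof -
    have e: "9 * i + 6 + 2 + 1 = 9 * i + 9" "3 * (3 * i + 2) = 9 * i + 6" by simp_all
    show ?thesis
      using sect_Forms[of f "3 * i + 2" 2 "E ^ 5 * beta ^ (12 + 9 * i)", unfolded e Fe_form, OF that] by simp
  qed
  show "sect 2 (Fo * hm ^ i) \<in> (*) 81 ` Mod Fe"
  proof (cases i)
    case 0
    let ?g = "E ^ 5 * beta ^ 12"
    \<comment> \<open>In (A + 2 L) D^4 the coefficients at L^2, L^5, L^8 are 18, 54, 9, so this part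
      is 9 times \<open>?h\<close>; the other monomials vanish under \<open>sect 2\<close>.\<close>
    let ?h = "2 * (A ^ 7 * L ^ 2) + 6 * (A ^ 4 * L ^ 5) + A ^ 1 * L ^ 8"
    have h: "?h \<in> Forms (9 * i + 9)"
      by (intro Forms_add Forms_numeral Forms_monomial) (simp_all add: 0)
    define M where "M s j = A ^ s * L ^ j * cub ?g" for s j
    define H where "H = ?h * cub ?g"
    have z: "sect 2 (M s j) = 0" if "j mod 3 \<noteq> 2" for s j
      using sect_monomial[of 2 s j ?g] that by (simp add: M_def)
    have "Fo = M 9 0 + 6 * M 8 1 + 36 * M 6 3 + 51 * M 5 4 + 42 * M 3 6 + 24 * M 2 7 + 2 * M 0 9 + 9 * H"
      unfolding Fo_D D_def M_def H_def by algebra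
    from arg_cong[OF this, of "sect 2"] have "sect 2 Fo = 9 * sect 2 H"
      by (simp add: sect_add sect_numeral z)
    then have "sect 2 Fo = 9 * sect 2 (?h * cub ?g)" by (simp only: H_def)
    then show ?thesis using mem_scale_mult[OF form[OF h], of 9] by (simp add: 0)
  next
    case (Suc i')
    have "(A + 2 * L) * D ^ 4 * (L * D ^ 4) ^ i \<in> Forms (9 * i + 9)" (is "?f \<in> _")
      by (intro Forms_mult[OF Forms_mult[OF Forms_A2L Forms_power[OF Forms_D refl] refl]
        Forms_power[OF Forms_mult[OF Forms_L Forms_power[OF Forms_D refl] refl] refl]]) simp
    from form[OF this] obtain g where g: "g \<in> Mod Fe" "sect 2 (?f * cub (E ^ 5 * beta ^ (12 + 9 * i))) = 9 * g" by blast
    have "sect 2 (Fo * hm ^ i) = 81 * (of_int (9 ^ i') * g)"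
      unfolding Fo_hm sect_numeral_power g(2) by (simp add: Suc)
    moreover have "of_int (9 ^ i') * g \<in> Mod Fe" by (rule zclosed_of_int[OF Mod_closed g(1)])
    ultimately show ?thesis by blast
  qed
qed

lemma Forms_Fe: "(A + 2 * L) * D ^ 5 * (L * D ^ 4) ^ i \<in> Forms (9 * i + 11)"
  by (intro Forms_mult[OF Forms_mult[OF Forms_A2L Forms_power[OF Forms_D refl] refl]
        Forms_power[OF Forms_mult[OF Forms_L Forms_power[OF Forms_D refl] refl] refl]]) simp

text \<open>Residue 1 gains 3 in every term; 9^i stays in the cofactor, being trivial for i =
  0.\<close>

lemma sect_Fe: "f \<in> Mod Fe \<Longrightarrow> sect 1 f \<in> (*) 3 ` Mod Fo"
  unfolding Mod_def[of Fe]
proof (erule zspan_into[OF _ zclosed_scale[OF Mod_closed] zlinear_sect], clarify)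
  fix i
  let ?f = "(A + 2 * L) * D ^ 5 * (L * D ^ 4) ^ i"
  have e: "9 * i + 9 + 1 + 1 = 9 * i + 11" "3 * (3 * i + 3) = 9 * i + 9" by simp_all
  have "sect 1 (?f * cub (E ^ 7 * beta ^ (15 + 9 * i))) \<in> (*) 3 ` Mod Fo"
    using sect_Forms[of ?f "3 * i + 3" 1 "E ^ 7 * beta ^ (15 + 9 * i)", unfolded e power_one_right Fo_form,
      OF Forms_Fe] by simp
  then obtain g where g: "g \<in> Mod Fo" "sect 1 (?f * cub (E ^ 7 * beta ^ (15 + 9 * i))) = 3 * g" by blast
  have "sect 1 (Fe * hm ^ i) = 3 * (of_int (9 ^ i) * g)"
    unfolding Fe_hm sect_numeral_power g(2) by simp
  moreover have "of_int (9 ^ i) * g \<in> Mod Fo" by (rule zclosed_of_int[OF Mod_closed g(1)])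
  ultimately show "sect 1 (Fe * hm ^ i) \<in> (*) 3 ` Mod Fo" by blast
qed

section \<open>Integrality and the congruences\<close>

definition ints :: "complex fps set" where "ints = {f. \<forall>n. f $ n \<in> \<int>}"

lemma ints_mult: "f \<in> ints \<Longrightarrow> g \<in> ints \<Longrightarrow> f * g \<in> ints"
  by (auto simp: ints_def fps_mult_nth intro!: Ints_sum)

lemma ints_add: "f \<in> ints \<Longrightarrow> g \<in> ints \<Longrightarrow> f + g \<in> ints"
  by (auto simp: ints_def)

lemma ints_of_int: "of_int c \<in> ints"
  by (auto simp: ints_def fps_of_int[symmetric])

lemma ints_numeral: "numeral c \<in> ints"
  using ints_of_int[of "numeral c"] by simp

lemma ints_power: "f \<in> ints \<Longrightarrow> f ^ n \<in> ints"
  by (induction n) (use ints_of_int[of 1] in \<open>auto intro: ints_mult\<close>)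

lemma ints_X: "fps_X \<in> ints"
  by (auto simp: ints_def)

lemma ints_cub: "f \<in> ints \<Longrightarrow> cub f \<in> ints"
  by (auto simp: ints_def cub_nth)

lemma ints_sect: "f \<in> ints \<Longrightarrow> sect r f \<in> ints"
  by (auto simp: ints_def sect_def)

lemma ints_gf: "gf X w one_wt \<in> ints"
  by (auto simp: ints_def gf_nth)

lemma ints_closed: "zclosed ints"
  unfolding zclosed_def using ints_of_int[of 0] by (auto intro: ints_add ints_mult ints_of_int)

text \<open>Since \<open>Q\<close> has constant term 1, Q E = 1 determines the coefficients of
  \<open>E\<close> recursively without division.\<close>

lemma ints_E: "E \<in> ints"
proof -
  have "E $ n \<in> \<int>" for n
  proof (induction n rule: less_induct)
    case (less n)
    show ?case
    proof (cases "n = 0")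
      case False
      have "Q \<in> ints" unfolding Q_def by (rule ints_gf)
      then have "(\<Sum>i=1..n. Q $ i * E $ (n - i)) \<in> \<int>"
        using less False by (intro Ints_sum) (auto simp: ints_def)
      moreover have "(\<Sum>i=0..n. Q $ i * E $ (n - i)) = 0"
        using Q_E False by (simp flip: fps_mult_nth)
      then have "E $ n = - (\<Sum>i=1..n. Q $ i * E $ (n - i))"
        by (simp add: sum.atLeast_Suc_atMost Q_0 add_eq_0_iff2)
      ultimately show ?thesis by simp
    qed (simp add: E_def Q_0)
  qed
  then show ?thesis by (simp add: ints_def)
qed

lemma ints_Q: "Q \<in> ints" and ints_theta_a: "theta_a \<in> ints" and ints_theta_c: "theta_c \<in> ints"
  by (simp_all add: Q_def theta_a_def theta_c_def ints_gf)

lemmas ints_intros = ints_Q ints_theta_a ints_theta_c ints_E ints_mult ints_add ints_power 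
  ints_numeral ints_X ints_cub

lemma ints_beta: "beta \<in> ints" and ints_Fo: "Fo \<in> ints" and ints_Fe: "Fe \<in> ints"
  unfolding beta_def Fo_def Fe_def by (intro ints_intros)+

lemma ints_hm: "hm \<in> ints"
  unfolding hm_def by (intro ints_intros ints_beta)

lemma Mod_ints: "F \<in> ints \<Longrightarrow> f \<in> Mod F \<Longrightarrow> f \<in> ints"
proof -
  assume F: "F \<in> ints" and f: "f \<in> Mod F"
  have "f * 1 \<in> ints"
    by (rule zspan_into[OF f[unfolded Mod_def] ints_closed zlinear_mult])
      (auto intro: ints_intros ints_hm F)
  then show "f \<in> ints" by simp
qed

text \<open>A surviving monomial has degree at least 2 in \<open>L\<close>, through the residue 2 or
  the factor L^2, and each \<open>L\<close> brings a factor 3.\<close>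

lemma sect_Forms_ints:
  assumes "f \<in> Forms d" "g \<in> ints" "r < 3" "r = 2 \<or> l = 2"
  shows "sect r (L ^ l * f * cub g) \<in> (*) 9 ` ints"
proof -
  have "sect r (f * (L ^ l * cub g)) \<in> (*) 9 ` ints"
  proof (rule zspan_into[OF assms(1)[unfolded Forms_def] zclosed_scale[OF ints_closed] zlinear_sect_mult])
    fix x assume "x \<in> {A ^ s * L ^ j |s j. s + j = d}"
    then obtain s j where x: "x = A ^ s * L ^ j" by blast
    have e: "x * (L ^ l * cub g) = A ^ s * L ^ (j + l) * cub g" by (simp add: x power_add mult_ac)
    show "sect r (x * (L ^ l * cub g)) \<in> (*) 9 ` ints"
    proof (cases "(j + l) mod 3 = r")
      case True
      have "2 \<le> j + l" using assms(4) True by presburger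
      then obtain t where t: "j + l = t + 2" by (metis add.commute le_Suc_ex)
      have "sect r (x * (L ^ l * cub g)) = 
        9 * (3 ^ t * (fps_X ^ ((j + l) div 3) * (theta_a ^ s * theta_c ^ (j + l) * g)))"
        unfolding e sect_monomial[OF assms(3)] using True by (simp add: t power_add)
      moreover have "3 ^ t * (fps_X ^ ((j + l) div 3) * (theta_a ^ s * theta_c ^ (j + l) * g)) \<in> ints"
        by (intro ints_intros assms)
      ultimately show ?thesis by blast
    next
      case False
      then show ?thesis using zclosed_scale[OF ints_closed, of 9] 
        unfolding e sect_monomial[OF assms(3)] by (simp add: zclosed_def)
    qed
  qed
  then show ?thesis by (simp add: mult_ac)
qed

lemma sect_Fe_9: "f \<in> Mod Fe \<Longrightarrow> sect 2 f \<in> (*) 9 ` ints"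
  unfolding Mod_def[of Fe]
proof (erule zspan_into[OF _ zclosed_scale[OF ints_closed] zlinear_sect], clarify)
  fix i
  let ?f = "(A + 2 * L) * D ^ 5 * (L * D ^ 4) ^ i"
  have "sect 2 (L ^ 0 * ?f * cub (E ^ 7 * beta ^ (15 + 9 * i))) \<in> (*) 9 ` ints"
    by (rule sect_Forms_ints[OF Forms_Fe]) (auto intro: ints_intros ints_beta)
  then obtain g where g: "g \<in> ints" "sect 2 (?f * cub (E ^ 7 * beta ^ (15 + 9 * i))) = 9 * g" by auto
  have "sect 2 (Fe * hm ^ i) = 9 * (9 ^ i * g)"
    unfolding Fe_hm sect_numeral_power g(2) by simp
  moreover have "9 ^ i * g \<in> ints" by (intro ints_intros g)
  ultimately show "sect 2 (Fe * hm ^ i) \<in> (*) 9 ` ints" by blast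
qed

text \<open>For i >= 1 the factor 9^i suffices. For i = 0 the monomial A^8 L brings one factor 3
  through \<open>L\<close> and another through its coefficient 6; the terms from L^2 on are
  collected in \<open>?h\<close>.\<close>

lemma sect_Fo_9: "f \<in> Mod Fo \<Longrightarrow> sect 1 f \<in> (*) 9 ` ints"
  unfolding Mod_def[of Fo]
proof (erule zspan_into[OF _ zclosed_scale[OF ints_closed] zlinear_sect], clarify)
  fix i
  show "sect 1 (Fo * hm ^ i) \<in> (*) 9 ` ints"
  proof (cases i)
    case 0
    let ?g = "E ^ 5 * beta ^ 12"
    let ?h = "18 * (A ^ 7 * L ^ 0) + 36 * (A ^ 6 * L ^ 1) + 51 * (A ^ 5 * L ^ 2) + 54 * (A ^ 4 * L ^ 3)
      + 42 * (A ^ 3 * L ^ 4) + 24 * (A ^ 2 * L ^ 5) + 9 * (A ^ 1 * L ^ 6) + 2 * (A ^ 0 * L ^ 7)"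
    have "?h \<in> Forms 7"
      by (intro Forms_add Forms_numeral Forms_monomial) simp_all
    then have "sect 1 (L\<^sup>2 * ?h * cub ?g) \<in> (*) 9 ` ints"
      by (rule sect_Forms_ints) (auto intro: ints_intros ints_beta)
    then obtain u where u: "u \<in> ints" "sect 1 (L\<^sup>2 * ?h * cub ?g) = 9 * u" by blast
    have Fo: "Fo = A ^ 9 * L ^ 0 * cub ?g + 6 * (A ^ 8 * L ^ 1 * cub ?g) + L\<^sup>2 * ?h * cub ?g"
      unfolding Fo_D D_def by algebra
    have s: "sect 1 (A ^ 9 * L ^ 0 * cub ?g) = 0"
      "sect 1 (A ^ 8 * L ^ 1 * cub ?g) = 3 * (theta_a ^ 8 * theta_c * ?g)"
      using sect_monomial[of 1 9 0 ?g] sect_monomial[of 1 8 1 ?g] by simp_all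
    have "sect 1 Fo = 18 * (theta_a ^ 8 * theta_c * ?g) + 9 * u"
      by (subst Fo) (simp add: sect_add sect_numeral u(2)[simplified] s[simplified])
    then have "sect 1 Fo = 9 * (2 * (theta_a ^ 8 * theta_c * ?g) + u)" by simp
    moreover have "2 * (theta_a ^ 8 * theta_c * ?g) + u \<in> ints"
      by (intro ints_intros ints_beta u)
    ultimately have "sect 1 Fo \<in> (*) 9 ` ints" by blast
    then show ?thesis by (simp add: 0)
  next
    case (Suc i')
    let ?u = "9 ^ i' * ((A + 2 * L) * D ^ 4 * (L * D ^ 4) ^ i * cub (E ^ 5 * beta ^ (12 + 9 * i)))"
    have "sect 1 (Fo * hm ^ i) = 9 * sect 1 ?u"
      unfolding Fo_hm by (simp add: Suc mult.assoc sect_numeral)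
    moreover have "?u \<in> ints"
      unfolding L_def D_def by (intro ints_intros ints_beta)
    ultimately show ?thesis by (blast intro: ints_sect)
  qed
qed

section \<open>Generating functions along the progressions\<close>

definition cphi_gf :: "nat \<Rightarrow> nat \<Rightarrow> complex fps" where
  "cphi_gf a b = Abs_fps (\<lambda>n. of_nat (cphi 3 (a * n + b)))"

lemma sect_cphi_gf: "a' = 3 * a \<Longrightarrow> b' = a * r + b \<Longrightarrow> sect r (cphi_gf a b) = cphi_gf a' b'"
  by (simp add: sect_def cphi_gf_def fps_eq_iff algebra_simps)

lemma nine_power: obtains t :: nat where "9 ^ k = 8 * t + 1"
proof -
  have "(9::nat) ^ k mod 8 = (9 mod 8) ^ k mod 8" by (rule power_mod[symmetric])
  then have "(9::nat) ^ k = 8 * (9 ^ k div 8) + 1"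
    using mult_div_mod_eq[of 8 "(9::nat) ^ k"] by simp
  then show ?thesis by (rule that)
qed

text \<open>Residue r of the progression a n + b has offset a r + b; these are the offset changes
  under one trisection. The quotients are exact because 9^k is 1 modulo 8.\<close>

lemma offsets:
  "(7 * 9 ^ Suc k + 1) div 8 = 3 * 9 ^ k * 2 + (5 * (3 * 9 ^ k) + 1) div (8::nat)"
  "(5 * (3 * 9 ^ k) + 1) div 8 = 9 ^ k * 1 + (7 * 9 ^ k + 1) div (8::nat)"
  "(23 * 9 ^ k + 1) div 8 = 9 ^ k * 2 + (7 * 9 ^ k + 1) div (8::nat)"
  "(13 * (3 * 9 ^ k) + 1) div 8 = 3 * 9 ^ k * 1 + (5 * (3 * 9 ^ k) + 1) div (8::nat)"
  using nine_power[of k] by auto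

lemma sect_scaled:
  assumes "f \<in> (*) (3 ^ e) ` S" "\<And>g. g \<in> S \<Longrightarrow> sect r g \<in> (*) (3 ^ d) ` T"
  shows "sect r f \<in> (*) (3 ^ (e + d)) ` T"
proof -
  obtain g where g: "g \<in> S" "f = 3 ^ e * g" using assms(1) by blast
  obtain h where h: "h \<in> T" "sect r g = 3 ^ d * h" using assms(2)[OF g(1)] by blast
  show ?thesis using h by (auto simp: g(2) sect_numeral_power power_add mult.assoc)
qed

text \<open>Starting from 27 \<open>Fo\<close> at modulus 3, residue 2 leads from odd to even powers
  with gain 81 and residue 1 back to odd ones with gain 3, hence 3^5 per cycle.\<close>

lemma cphi_gf_odd: 
  "cphi_gf (3 * 9 ^ k) ((5 * (3 * 9 ^ k) + 1) div 8) \<in> (*) (3 ^ (5 * k + 3)) ` Mod Fo" (is "?o k")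
  and cphi_gf_even:
  "cphi_gf (9 ^ Suc k) ((7 * 9 ^ Suc k + 1) div 8) \<in> (*) (3 ^ (5 * k + 7)) ` Mod Fe" (is "?e k")
proof -
  have even: "?e k" if "?o k" for k
  proof -
    have "sect 2 (cphi_gf (3 * 9 ^ k) ((5 * (3 * 9 ^ k) + 1) div 8)) \<in> (*) (3 ^ (5 * k + 3 + 4)) ` Mod Fe"
      by (rule sect_scaled[OF that]) (use sect_Fo in simp)
    then show ?thesis by (subst (asm) sect_cphi_gf[OF _ offsets(1)]) (simp_all add: add.assoc)
  qed
  have odd: "?o (Suc k)" if "?e k" for k
  proof -
    have "sect 1 (cphi_gf (9 ^ Suc k) ((7 * 9 ^ Suc k + 1) div 8)) \<in> (*) (3 ^ (5 * k + 7 + 1)) ` Mod Fo"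
      by (rule sect_scaled[OF that]) (use sect_Fe in simp)
    then show ?thesis by (subst (asm) sect_cphi_gf[OF _ offsets(2)]) (simp_all add: add.assoc)
  qed
  have "cphi_gf 3 2 = sect 2 (theta_a * Q ^ 3)"
    unfolding cphi_3_gf[symmetric] by (simp add: cphi_gf_def sect_def)
  moreover have "Fo * hm ^ 0 \<in> Mod Fo" unfolding Mod_def by (rule zspan_base) blast
  ultimately have 0: "?o 0" by (simp add: sect_start)
  show o: "?o k" by (induction k) (use 0 odd even in blast)+
  then show "?e k" by (rule even)
qed

lemma cong_of_ints:
  assumes "cphi_gf a b \<in> (*) (3 ^ e) ` ints" "d \<le> e"
  shows "[cphi 3 (a * n + b) = 0] (mod 3 ^ d)"
proof -
  obtain g where g: "g \<in> ints" "cphi_gf a b = 3 ^ e * g" using assms(1) by blast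
  from g(1) obtain z where z: "g $ n = of_int z" unfolding ints_def by (auto elim: Ints_cases)
  have "of_nat (cphi 3 (a * n + b)) = (of_int (3 ^ e) * g) $ n"
    using g(2) by (simp add: cphi_gf_def flip: fps_nth_Abs_fps[of "\<lambda>n. of_nat (cphi 3 (a * n + b))" n])
  then have "complex_of_int (int (cphi 3 (a * n + b))) = of_int (3 ^ e * z)"
    unfolding of_int_mult_nth z by simp
  then have "int (cphi 3 (a * n + b)) = int (3 ^ e) * z" by (simp only: of_int_eq_iff) simp
  then have "3 ^ e dvd cphi 3 (a * n + b)" by (metis dvd_triv_left int_dvd_int_iff)
  then show ?thesis using assms(2) by (metis cong_0_iff dvd_trans le_imp_power_dvd)
qed

theorem theorem1p2:
  fixes k n :: nat
  assumes "k \<ge> 3"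
  shows "[cphi 3 (3 ^ (2*k) * n + (7 * 3 ^ (2*k) + 1) div 8) = 0] (mod 3 ^ (4*k + 5)) \<and>
         [cphi 3 (3 ^ (2*k + 1) * n + (5 * 3 ^ (2*k + 1) + 1) div 8) = 0] (mod 3 ^ (4*k + 6)) \<and>
         [cphi 3 (3 ^ (2*k + 1) * n + (23 * 3 ^ (2*k) + 1) div 8) = 0] (mod 3 ^ (4*k + 7)) \<and>
         [cphi 3 (3 ^ (2*k + 2) * n + (13 * 3 ^ (2*k + 1) + 1) div 8) = 0] (mod 3 ^ (4*k + 8))"
proof -
  obtain j where k: "k = Suc j" using assms by (cases k) auto
  have p: "3 ^ (2 * k) = (9::nat) ^ k" "3 ^ (2 * k + 1) = 3 * (9::nat) ^ k" "3 ^ (2 * k + 2) = 3 * (3 * (9::nat) ^ k)"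
    by (simp_all add: power_mult)
  have even: "cphi_gf (9 ^ k) ((7 * 9 ^ k + 1) div 8) \<in> (*) (3 ^ (5 * k + 2)) ` Mod Fe"
  proof -
    have e: "5 * k + 2 = 5 * j + 7" by (simp add: k)
    show ?thesis unfolding e unfolding k by (rule cphi_gf_even)
  qed
  note odd = cphi_gf_odd[of k]
  have "cphi_gf (9 ^ k) ((7 * 9 ^ k + 1) div 8) \<in> (*) (3 ^ (5 * k + 2)) ` ints"
    using even Mod_ints[OF ints_Fe] by blast
  moreover have "cphi_gf (3 * 9 ^ k) ((5 * (3 * 9 ^ k) + 1) div 8) \<in> (*) (3 ^ (5 * k + 3)) ` ints"
    using odd Mod_ints[OF ints_Fo] by blast
  \<comment> \<open>The main progression is left through the other residue class, with a gain of 9;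
    likewise for the odd power below.\<close>
  moreover have "sect 2 (cphi_gf (9 ^ k) ((7 * 9 ^ k + 1) div 8)) \<in> (*) (3 ^ (5 * k + 2 + 2)) ` ints"
    by (rule sect_scaled[OF even]) (use sect_Fe_9 in simp)
  then have "cphi_gf (3 * 9 ^ k) ((23 * 9 ^ k + 1) div 8) \<in> (*) (3 ^ (5 * k + 2 + 2)) ` ints"
    by (subst (asm) sect_cphi_gf[OF refl offsets(3)])
  moreover have "sect 1 (cphi_gf (3 * 9 ^ k) ((5 * (3 * 9 ^ k) + 1) div 8)) \<in> (*) (3 ^ (5 * k + 3 + 2)) ` ints"
    by (rule sect_scaled[OF odd]) (use sect_Fo_9 in simp)
  then have "cphi_gf (3 * (3 * 9 ^ k)) ((13 * (3 * 9 ^ k) + 1) div 8) \<in> (*) (3 ^ (5 * k + 3 + 2)) ` ints"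
    by (subst (asm) sect_cphi_gf[OF refl offsets(4)])
  \<comment> \<open>The available exponents 5 k + 2, 5 k + 3, 5 k + 4, 5 k + 5 reach 4 k + 5, 4 k +
    6, 4 k + 7, 4 k + 8 because k >= 3.\<close>
  ultimately show ?thesis
    unfolding p using assms by (intro conjI; elim cong_of_ints) simp_all
qed

end
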